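(* Let $F$ be a connected graph that contains two vertex-disjoint cycles of equal length whose union spans $V(F)$. Then for every real number $\varepsilon > 0$ there exists a constant $C = C(F,\varepsilon) > 0$ such that the following holds. For all positive integers $n$ and $m$ with $n$ divisible by $|V(F)|$ and $m \geq Cn$, $$N_F(n,m) \leq \left[(1+\varepsilon)\left(\frac{|V(F)|}{|\mathrm{Aut}(F)|}\right)^{\frac{1}{|V(F)|-1}} \frac{2m}{en}\right]^{\left(1-\frac{1}{|V(F)|}\right)n}.$$ Moreover, this bound is asymptotically sharp for infinitely many pairs $(n,m)$: for every $\delta\in(0,1)$ there are infinitely many pairs $(n,m)$ of positive integers with $n$ divisible by $|V(F)|$ and $m\ge Cn$ such that $$N_F(n,m) \geq \left[(1-\delta)\left(\frac{|V(F)|}{|\mathrm{Aut}(F)|}\right)^{\frac{1}{|V(F)|-1}} \frac{2m}{en}\right]^{\left(1-\frac{1}{|V(F)|}\right)n}.$$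
   Context: All graphs are finite and simple. $\mathrm{Aut}(F)$ is the automorphism group of $F$ and $e$ is Euler's number. An $F$-factor of a graph $G$ is a spanning subgraph of $G$ that is a vertex-disjoint union of copies of $F$. $N_F(n,m)$ denotes the maximum number of distinct $F$-factors in $G$ over all graphs $G$ with exactly $n$ vertices and exactly $m$ edges (taken to be $0$ if no such graph exists). Cycles $C_\ell$ have length $\ell\ge 2$, where by convention $C_2$ is a single edge. *)

theory Defs
  imports Complex_Main "HOL-Combinatorics.Permutations"
begin

text \<open>A graph is a pair of a vertex set and a set of edges, an edge being a two-element set of
  vertices.\<close>

type_synonym 'a graph = "'a set \<times> 'a set set"

abbreviation verts :: "'a graph \<Rightarrow> 'a set" where
  "verts G \<equiv> fst G"

abbreviation edges :: "'a graph \<Rightarrow> 'a set set" where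
  "edges G \<equiv> snd G"

definition simple_graph :: "'a graph \<Rightarrow> bool" where
  "simple_graph G \<longleftrightarrow> finite (verts G) \<and> (\<forall>e\<in>edges G. e \<subseteq> verts G \<and> card e = 2)"

definition connected_graph :: "'a graph \<Rightarrow> bool" where
  "connected_graph G \<longleftrightarrow> verts G \<noteq> {} \<and>
     (\<forall>u\<in>verts G. \<forall>v\<in>verts G. (u, v) \<in> {(x, y). {x, y} \<in> edges G}\<^sup>*)"

definition subgraph :: "'a graph \<Rightarrow> 'a graph \<Rightarrow> bool" where
  "subgraph H G \<longleftrightarrow> simple_graph H \<and> verts H \<subseteq> verts G \<and> edges H \<subseteq> edges G"

definition graph_iso :: "'a graph \<Rightarrow> 'b graph \<Rightarrow> bool" where
  "graph_iso G H \<longleftrightarrow> (\<exists>f. bij_betw f (verts G) (verts H) \<and> (\<lambda>e. f ` e) ` edges G = edges H)"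

text \<open>Automorphisms are extended by the identity outside the vertex set, so that each of them is
  represented by exactly one function.\<close>

definition Aut :: "'a graph \<Rightarrow> ('a \<Rightarrow> 'a) set" where
  "Aut G = {f. f permutes verts G \<and> (\<lambda>e. f ` e) ` edges G = edges G}"

text \<open>The cycle of length \<open>l\<close>, used for \<open>l \<ge> 2\<close> only. For \<open>l = 2\<close> it is a single edge.\<close>

definition cycle_graph :: "nat \<Rightarrow> nat graph" where
  "cycle_graph l = ({..<l}, {{i, Suc i mod l} |i. i < l})"

definition spanned_by_two_equal_cycles :: "'a graph \<Rightarrow> bool" where
  "spanned_by_two_equal_cycles F \<longleftrightarrow>
     (\<exists>l\<ge>2. \<exists>A B. subgraph A F \<and> subgraph B F \<and>
        graph_iso A (cycle_graph l) \<and> graph_iso B (cycle_graph l) \<and>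
        verts A \<inter> verts B = {} \<and> verts A \<union> verts B = verts F)"

definition disjoint_union_of_copies :: "'b graph \<Rightarrow> 'a graph \<Rightarrow> bool" where
  "disjoint_union_of_copies F H \<longleftrightarrow>
     (\<exists>K. (\<forall>A\<in>K. simple_graph A \<and> graph_iso A F) \<and>
          (\<forall>A\<in>K. \<forall>B\<in>K. A \<noteq> B \<longrightarrow> verts A \<inter> verts B = {}) \<and>
          verts H = (\<Union>A\<in>K. verts A) \<and> edges H = (\<Union>A\<in>K. edges A))"

text \<open>A factor is a subgraph: two factors are the same iff they have the same edges.\<close>

definition factors :: "'b graph \<Rightarrow> 'a graph \<Rightarrow> 'a graph set" where
  "factors F G = {H. subgraph H G \<and> verts H = verts G \<and> disjoint_union_of_copies F H}"

text \<open>Every finite graph is isomorphic to one whose vertices are natural numbers, so only those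
  are considered.\<close>

definition graphs_with :: "nat \<Rightarrow> nat \<Rightarrow> nat graph set" where
  "graphs_with n m = {G. simple_graph G \<and> card (verts G) = n \<and> card (edges G) = m}"

definition max_factors :: "'b graph \<Rightarrow> nat \<Rightarrow> nat \<Rightarrow> nat" where
  "max_factors F n m =
     (if graphs_with n m = {} then 0 else Max ((\<lambda>G. card (factors F G)) ` graphs_with n m))"

text \<open>The maximum is taken over a finite set of numbers.\<close>

lemma card_factors_le:
  assumes "G \<in> graphs_with n m"
  shows "finite (factors F G)" "card (factors F G) \<le> 2 ^ m"
proof -
  have "edges G \<subseteq> Pow (verts G)" "finite (verts G)"
    using assms by (auto simp: graphs_with_def simple_graph_def)
  then have fin: "finite (edges G)"
    by (meson finite_Pow_iff finite_subset)
  have sub: "factors F G \<subseteq> {verts G} \<times> Pow (edges G)"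
    by (auto simp: factors_def subgraph_def)
  show "finite (factors F G)"
    using finite_subset[OF sub] fin by simp
  have "card (factors F G) \<le> card ({verts G} \<times> Pow (edges G))"
    using sub fin by (intro card_mono) auto
  then show "card (factors F G) \<le> 2 ^ m"
    using assms fin by (simp add: card_cartesian_product card_Pow graphs_with_def)
qed

lemma finite_card_factors: "finite ((\<lambda>G. card (factors F G)) ` graphs_with n m)"
  by (rule finite_subset[of _ "{..2 ^ m}"]) (auto intro: card_factors_le)

end

theory Submission imports Defs
begin

text \<open>
  Let \<open>k\<close> be the number of vertices of \<open>F\<close>, let \<open>a\<close> be the number of its automorphisms, and let
  \<open>n = k * t\<close>. Opening the two cycles at the ends of an edge that joins them turns \<open>F\<close> into a graph
  with a Hamiltonian path (lemma \<open>hamiltonian_path\<close>). The upper bound is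
  obtained by following this path through the copies of \<open>F\<close>.

  \<^bold>\<open>From factors to paths.\<close> Order the components of an \<open>F\<close>-factor of \<open>G\<close> and choose an isomorphism
  from \<open>F\<close> to each of them. Since \<open>F\<close> is connected, every factor admits exactly \<open>t! * a ^ t\<close> such
  choices (\<open>card_placements_into\<close>, \<open>card_Aut_copies\<close>). The Hamiltonian path of \<open>F\<close> turns a choice
  into an ordered partition of \<open>V(G)\<close> into \<open>t\<close> directed paths on \<open>k\<close> vertices, and the choice can be
  read off from it. So it suffices to bound the number of these path tilings by
  \<open>t! * k ^ t * ((1 + o(1)) * 2 m / (e n)) ^ ((k - 1) * t)\<close>. For the complete graph all \<open>n!\<close>
  bijections are allowed, and Stirling's formula shows that the bound is attained asymptotically
  (\<open>max_factors_lower_bound\<close>).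

  \<^bold>\<open>Entropy.\<close> Pick one of the \<open>M\<close> tilings uniformly at random and reveal it path by path. If \<open>Q\<close> is any
  assignment of weights of total at most 1 to the tilings, then \<open>ln M\<close> is at most the average of
  \<open>- ln Q\<close>. The weight \<open>Q\<close> used here is built step by step: the start of a path is chosen
  among the vertices outside the earlier paths, with probability proportional to the frequency
  \<open>s(v)\<close> with which \<open>v\<close> is a start; each further vertex is chosen uniformly among the neighbours of
  its predecessor that lie outside the earlier paths. The set of tilings is invariant under
  exchanging two paths. Therefore, before the \<open>j\<close>-th path of \<open>t\<close>, a fraction of about \<open>1 - j / t\<close> of the
  neighbours of a vertex is still available, on average. Averaging the logarithm of this fraction
  over \<open>j\<close> gives \<open>- 1\<close>, the source of the factor \<open>1 / e\<close> per step. The result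
  (\<open>ln_card_tilings_le\<close>) is, up to small errors,
  \<open>ln M \<le> ln t! + (\<Sum>v. (1 - s(v)) * ln (deg v) - s(v) * ln (s(v))) - (k - 1) * t\<close>.
  The weight of \<open>ln (deg v)\<close> is the probability that \<open>v\<close> is not the \<^emph>\<open>end\<close> of its path. Reversing all
  paths shows that ends and starts have the same distribution, so this is \<open>1 - s(v)\<close>.

  \<^bold>\<open>Optimisation.\<close> The numbers \<open>s(v)\<close> have sum \<open>t\<close> and are at most \<open>1 / 2\<close>, because a start is not an
  end. Under these constraints, and for a given sum of the degrees, the sum is largest when \<open>s\<close> and the degrees are constant
  (\<open>sum_entropy_ln_le\<close>), that is, for \<open>s = 1 / k\<close> and \<open>deg = 2 m / n\<close>, which is the bound claimed. To keep the
  error terms small even at vertices of small degree, every degree is first increased by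
  \<open>\<epsilon> m / n\<close>, which costs a factor \<open>1 + \<epsilon> / 2\<close> in the average degree.
\<close>

section \<open>Sequential weights\<close>

text \<open>If the possible next letters after every prefix have total weight at most 1, then so have the words of
  length \<open>n\<close>. A path is such a word over the vertices, and a tiling is such a word over the paths.\<close>

lemma sum_sequential_weights_le_1:
  fixes w :: "'a list \<Rightarrow> 'a \<Rightarrow> real"
  assumes fin: "finite X" and nonneg: "\<And>p u. w p u \<ge> 0"
    and le1: "\<And>p. set p \<subseteq> X \<Longrightarrow> (\<Sum>u\<in>X. w p u) \<le> 1"
  shows "(\<Sum>xs | set xs \<subseteq> X \<and> length xs = n. \<Prod>q<n. w (take q xs) (xs ! q)) \<le> 1"
proof (induction n)
  case 0
  have "{xs :: 'a list. set xs \<subseteq> X \<and> length xs = 0} = {[]}" by auto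
  then show ?case by simp
next
  case (Suc n)
  let ?L = "\<lambda>n. {xs :: 'a list. set xs \<subseteq> X \<and> length xs = n}"
  let ?W = "\<lambda>n xs. \<Prod>q<n. w (take q xs) (xs ! q)"
  have img: "?L (Suc n) = (\<lambda>(xs, u). xs @ [u]) ` (?L n \<times> X)"
  proof (intro equalityI subsetI)
    fix xs assume "xs \<in> ?L (Suc n)"
    then have "xs = butlast xs @ [last xs]" "butlast xs \<in> ?L n" "last xs \<in> X"
      by (cases xs rule: rev_cases; auto)+
    then show "xs \<in> (\<lambda>(xs, u). xs @ [u]) ` (?L n \<times> X)"
      by (metis (mono_tags, lifting) SigmaI case_prod_conv image_eqI)
  qed auto
  have inj: "inj_on (\<lambda>(xs, u). xs @ [u]) (?L n \<times> X)"
    by (auto simp: inj_on_def)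
  have "(\<Sum>xs\<in>?L (Suc n). ?W (Suc n) xs) = (\<Sum>(xs, u)\<in>?L n \<times> X. ?W (Suc n) (xs @ [u]))"
    unfolding img by (subst sum.reindex[OF inj]) (simp add: case_prod_unfold)
  also have "\<dots> = (\<Sum>(xs, u)\<in>?L n \<times> X. ?W n xs * w xs u)"
    by (intro sum.cong) (auto simp: nth_append)
  also have "\<dots> = (\<Sum>xs\<in>?L n. ?W n xs * (\<Sum>u\<in>X. w xs u))"
    by (simp add: sum.cartesian_product[symmetric] sum_distrib_left)
  also have "\<dots> \<le> (\<Sum>xs\<in>?L n. ?W n xs * 1)"
    by (intro sum_mono mult_left_mono le1) (auto intro!: prod_nonneg nonneg)
  also have "\<dots> \<le> 1" using Suc.IH by simp
  finally show ?case .
qed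

text \<open>This is Gibbs' inequality for the uniform distribution on \<open>A\<close>. It follows from \<open>ln x \<le> x - 1\<close> for
  \<open>x = card A * Q x\<close>, and it replaces all computations with entropies.\<close>

lemma card_ln_card_le_sum_minus_ln:
  fixes Q :: "'a \<Rightarrow> real"
  assumes "finite A" "\<And>x. x \<in> A \<Longrightarrow> Q x > 0" "(\<Sum>x\<in>A. Q x) \<le> 1"
  shows "card A * ln (card A) \<le> (\<Sum>x\<in>A. - ln (Q x))"
proof (cases "A = {}")
  case False
  then have M: "real (card A) > 0" using assms(1) by (simp add: card_gt_0_iff)
  have "(\<Sum>x\<in>A. ln (card A * Q x)) \<le> (\<Sum>x\<in>A. card A * Q x - 1)"
    using M assms(2) by (intro sum_mono ln_le_minus_one) simp
  also have "\<dots> = card A * (\<Sum>x\<in>A. Q x) - card A"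
    by (simp add: sum_subtractf sum_distrib_left)
  also have "\<dots> \<le> 0" using M assms(3) by (simp add: mult_left_le)
  also have "(\<Sum>x\<in>A. ln (card A * Q x)) = (\<Sum>x\<in>A. ln (card A) + ln (Q x))"
    using M assms(2) by (intro sum.cong refl ln_mult_pos) auto
  finally show ?thesis by (simp add: sum.distrib sum_negf)
qed auto

text \<open>The concavity of the logarithm in the form used for all averages below: after a good choice of \<open>c\<close>
  only the expectation of \<open>x\<close> matters.\<close>

lemma ln_le_tangent:
  fixes x c :: real
  assumes "x > 0" "c > 0"
  shows "ln x \<le> ln c + x / c - 1"
  using ln_le_minus_one[of "x / c"] assms by (simp add: ln_div)

section \<open>Tilings by directed paths\<close>

locale path_tilings =
  fixes V :: "'v set" and E :: "'v set set" and k t :: nat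
  assumes finite_V: "finite V" and edge: "\<And>e. e \<in> E \<Longrightarrow> e \<subseteq> V \<and> card e = 2" and k_ge_2: "k \<ge> 2"
begin

definition nbrs :: "'v \<Rightarrow> 'v set" where
  "nbrs v = {u. {v, u} \<in> E}"

abbreviation deg :: "'v \<Rightarrow> nat" where
  "deg v \<equiv> card (nbrs v)"

abbreviation D :: "(nat \<times> nat) set" where
  "D \<equiv> {..<t} \<times> {..<k}"

text \<open>The value \<open>f (j, i)\<close> is the vertex number \<open>i\<close> of path number \<open>j\<close>. The value outside \<open>D\<close> is fixed so that
  every tiling is represented by one function.\<close>

definition tilings :: "(nat \<times> nat \<Rightarrow> 'v) set" where
  "tilings = {f. bij_betw f D V \<and> (\<forall>p. p \<notin> D \<longrightarrow> f p = undefined) \<and>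
     (\<forall>j<t. \<forall>i. Suc i < k \<longrightarrow> {f (j, i), f (j, Suc i)} \<in> E)}"

definition start_freq :: "'v \<Rightarrow> real" where
  "start_freq v = card {f \<in> tilings. \<exists>j<t. f (j, 0) = v} / card tilings"

lemma nbrs_subset: "nbrs v \<subseteq> V"
  using edge by (auto simp: nbrs_def)

lemma finite_nbrs: "finite (nbrs v)"
  using nbrs_subset finite_V finite_subset by blast

lemma finite_tilings: "finite tilings"
proof (rule finite_subset)
  show "tilings \<subseteq> {f. f ` D \<subseteq> V \<and> (\<forall>p. p \<notin> D \<longrightarrow> f p = undefined)}"
    by (auto simp: tilings_def bij_betw_def)
  have "{f. f ` D \<subseteq> V \<and> (\<forall>p. p \<notin> D \<longrightarrow> f p = undefined)} = (D \<rightarrow>\<^sub>E V)"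
    by (auto simp: PiE_def extensional_def)
  then show "finite {f. f ` D \<subseteq> V \<and> (\<forall>p. p \<notin> D \<longrightarrow> f p = undefined)}"
    by (simp add: finite_PiE finite_V)
qed

lemma tiling_bij: "f \<in> tilings \<Longrightarrow> bij_betw f D V"
  by (simp add: tilings_def)

lemma tiling_outside: "f \<in> tilings \<Longrightarrow> p \<notin> D \<Longrightarrow> f p = undefined"
  by (simp add: tilings_def del: split_paired_All)

lemma tiling_in_V: "f \<in> tilings \<Longrightarrow> j < t \<Longrightarrow> i < k \<Longrightarrow> f (j, i) \<in> V"
  by (auto simp: tilings_def bij_betw_def)

lemma tiling_eq_iff:
  "f \<in> tilings \<Longrightarrow> j < t \<Longrightarrow> i < k \<Longrightarrow> j' < t \<Longrightarrow> i' < k \<Longrightarrow> f (j, i) = f (j', i') \<longleftrightarrow> j = j' \<and> i = i'"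
  using inj_on_eq_iff[of f D "(j, i)" "(j', i')"] by (auto simp: tilings_def bij_betw_def)

lemma sum_V_eq_sum_tiling:
  fixes h :: "'v \<Rightarrow> real"
  assumes "f \<in> tilings"
  shows "(\<Sum>v\<in>V. h v) = (\<Sum>j<t. \<Sum>i<k. h (f (j, i)))"
  using sum.reindex_bij_betw[OF tiling_bij[OF assms], of h]
  by (simp add: sum.cartesian_product)

lemma swap_blocks:
  assumes "f \<in> tilings" "b < t" "c < t"
  shows "f \<circ> map_prod (transpose b c) id \<in> tilings"
proof -
  let ?s = "map_prod (transpose b c) (id :: nat \<Rightarrow> nat)"
  have tr: "transpose b c j < t \<longleftrightarrow> j < t" for j
    using assms by (auto simp: transpose_def)
  have "bij_betw ?s D D"
    by (rule bij_betwI[where g = ?s]) (auto simp: tr)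
  then have "bij_betw (f \<circ> ?s) D V"
    using tiling_bij[OF assms(1)] by (rule bij_betw_trans)
  then show ?thesis
    using assms(1) by (auto simp: tilings_def tr)
qed

lemma sum_tilings_swap:
  assumes "b < t" "c < t"
  shows "(\<Sum>f\<in>tilings. h f) = (\<Sum>f\<in>tilings. h (f \<circ> map_prod (transpose b c) id))"
proof -
  have inv: "(f \<circ> map_prod (transpose b c) id) \<circ> map_prod (transpose b c) id = f" for f :: "nat \<times> nat \<Rightarrow> 'v"
    by (auto simp: fun_eq_iff)
  show ?thesis
    by (rule sum.reindex_bij_witness[where i = "\<lambda>f. f \<circ> map_prod (transpose b c) id"
          and j = "\<lambda>f. f \<circ> map_prod (transpose b c) id"])
      (auto simp only: inv swap_blocks[OF _ assms])
qed

definition reverse_blocks :: "(nat \<times> nat \<Rightarrow> 'v) \<Rightarrow> (nat \<times> nat \<Rightarrow> 'v)" where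
  "reverse_blocks f = f \<circ> map_prod id (\<lambda>i. if i < k then k - 1 - i else i)"

lemma reverse_blocks_in:
  assumes "f \<in> tilings"
  shows "reverse_blocks f \<in> tilings"
proof -
  let ?s = "map_prod (id :: nat \<Rightarrow> nat) (\<lambda>i. if i < k then k - 1 - i else i)"
  have "bij_betw ?s D D"
    by (rule bij_betwI[where g = ?s]) auto
  then have bij: "bij_betw (reverse_blocks f) D V"
    unfolding reverse_blocks_def using tiling_bij[OF assms(1)] by (rule bij_betw_trans)
  have "{f (j, k - 1 - i), f (j, k - 1 - Suc i)} \<in> E" if "j < t" "Suc i < k" for i j
  proof -
    have "k - 1 - i = Suc (k - 1 - Suc i)" "Suc (k - 1 - Suc i) < k" using that by auto
    then show ?thesis
      using assms that by (simp add: tilings_def insert_commute)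
  qed
  then show ?thesis
    using assms(1) bij by (auto simp: tilings_def reverse_blocks_def)
qed

text \<open>This symmetry is what makes the bound depend on a single distribution \<open>start_freq\<close>: the out-degree
  of \<open>v\<close> counts unless \<open>v\<close> is the end of its path.\<close>

lemma card_end_eq_card_start:
  "card {f \<in> tilings. \<exists>j<t. f (j, k - 1) = v} = card {f \<in> tilings. \<exists>j<t. f (j, 0) = v}"
proof (rule bij_betw_same_card)
  have inv: "reverse_blocks (reverse_blocks f) = f" for f
    by (auto simp: fun_eq_iff reverse_blocks_def)
  show "bij_betw reverse_blocks {f \<in> tilings. \<exists>j<t. f (j, k - 1) = v} {f \<in> tilings. \<exists>j<t. f (j, 0) = v}"
    by (rule bij_betwI[where g = reverse_blocks])
      (use k_ge_2 in \<open>auto simp: inv reverse_blocks_in, auto simp: reverse_blocks_def\<close>)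
qed

lemma sum_tilings_position:
  fixes h :: "'v \<Rightarrow> real"
  assumes "i < k"
  shows "(\<Sum>f\<in>tilings. \<Sum>j<t. h (f (j, i))) =
    (\<Sum>v\<in>V. card {f \<in> tilings. \<exists>j<t. f (j, i) = v} * h v)"
proof -
  have "(\<Sum>j<t. h (f (j, i))) = (\<Sum>v\<in>V. if \<exists>j<t. f (j, i) = v then h v else 0)" if f: "f \<in> tilings" for f
  proof -
    have inj: "inj_on (\<lambda>j. f (j, i)) {..<t}"
      using tiling_eq_iff[OF f] assms by (auto simp: inj_on_def)
    have "(\<Sum>v\<in>V. if \<exists>j<t. f (j, i) = v then h v else 0) = (\<Sum>v\<in>{v\<in>V. \<exists>j<t. f (j, i) = v}. h v)"
      using finite_V by (simp add: sum.inter_filter)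
    also have "{v\<in>V. \<exists>j<t. f (j, i) = v} = (\<lambda>j. f (j, i)) ` {..<t}"
      using tiling_in_V[OF f] assms by auto
    finally show ?thesis by (simp add: sum.reindex[OF inj])
  qed
  then have "(\<Sum>f\<in>tilings. \<Sum>j<t. h (f (j, i))) =
      (\<Sum>f\<in>tilings. \<Sum>v\<in>V. if \<exists>j<t. f (j, i) = v then h v else 0)" by simp
  also have "\<dots> = (\<Sum>v\<in>V. \<Sum>f\<in>tilings. if \<exists>j<t. f (j, i) = v then h v else 0)"
    by (rule sum.swap)
  also have "\<dots> = (\<Sum>v\<in>V. card {f \<in> tilings. \<exists>j<t. f (j, i) = v} * h v)"
    by (simp add: sum.inter_filter[OF finite_tilings, symmetric])
  finally show ?thesis .
qed

end

locale nonempty_path_tilings = path_tilings V E k t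
  for V :: "'v set" and E :: "'v set set" and k t :: nat +
  assumes nonempty: "tilings \<noteq> {}"
begin

abbreviation M :: real where "M \<equiv> real (card tilings)"

lemma M_pos: "M > 0"
  using nonempty finite_tilings by (simp add: card_gt_0_iff)

lemma sum_starts:
  "(\<Sum>f\<in>tilings. \<Sum>j<t. h (f (j, 0))) = M * (\<Sum>v\<in>V. start_freq v * h v)"
  using sum_tilings_position[of 0 h] k_ge_2 M_pos
  by (simp add: start_freq_def sum_distrib_left)

lemma sum_ends:
  "(\<Sum>f\<in>tilings. \<Sum>j<t. h (f (j, k - 1))) = M * (\<Sum>v\<in>V. start_freq v * h v)"
  using sum_tilings_position[of "k - 1" h] k_ge_2 M_pos
  unfolding card_end_eq_card_start by (simp add: start_freq_def sum_distrib_left)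

lemma sum_start_freq: "(\<Sum>v\<in>V. start_freq v) = t"
  using sum_starts[of "\<lambda>_. 1"] M_pos by simp

lemma start_freq_nonneg: "start_freq v \<ge> 0"
  by (simp add: start_freq_def)

lemma start_freq_pos:
  assumes "f \<in> tilings" "j < t"
  shows "start_freq (f (j, 0)) > 0"
proof -
  have "f \<in> {g \<in> tilings. \<exists>j'<t. g (j', 0) = f (j, 0)}" using assms by auto
  then have "card {g \<in> tilings. \<exists>j'<t. g (j', 0) = f (j, 0)} > 0"
    using finite_tilings by (subst card_gt_0_iff) auto
  then show ?thesis using M_pos by (simp add: start_freq_def)
qed

text \<open>A path has at least two vertices, so \<open>v\<close> is never both a start and an end, and the two events have the
  same probability. The value \<open>1 / 2\<close> is where the function of \<open>start_entropy_le_tangent\<close> stops being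
  concave.\<close>

lemma start_freq_le_half: "start_freq v \<le> 1 / 2"
proof -
  let ?S = "{f \<in> tilings. \<exists>j<t. f (j, 0) = v}" and ?T = "{f \<in> tilings. \<exists>j<t. f (j, k - 1) = v}"
  have "?S \<inter> ?T = {}"
    using tiling_eq_iff[of _ _ 0 _ "k - 1"] k_ge_2 by force
  then have "card ?S + card ?T = card (?S \<union> ?T)"
    using finite_tilings by (simp add: card_Un_disjoint)
  also have "\<dots> \<le> card tilings" by (intro card_mono finite_tilings) auto
  finally have "2 * card ?S \<le> card tilings" using card_end_eq_card_start[of v] by linarith
  then have "2 * real (card ?S) \<le> M" by linarith
  then show ?thesis using M_pos by (simp add: start_freq_def field_simps)
qed

definition used :: "(nat \<times> nat \<Rightarrow> 'v) \<Rightarrow> nat \<Rightarrow> 'v set" where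
  "used f j = f ` ({..<j} \<times> {..<k})"

text \<open>The conditional weight of the next vertex \<open>u\<close> of a path, given the initial part \<open>p\<close> of the path and the
  set \<open>U\<close> of vertices on earlier paths. The choice ignores that \<open>u\<close> must not occur in \<open>p\<close>: at most \<open>k\<close>
  neighbours are lost in this way, a negligible number for large degrees.\<close>

definition step_weight :: "'v set \<Rightarrow> 'v list \<Rightarrow> 'v \<Rightarrow> real" where
  "step_weight U p u =
    (if p = [] then if u \<in> V - U then start_freq u / sum start_freq (V - U) else 0
     else if u \<in> nbrs (last p) - U then 1 / card (nbrs (last p) - U) else 0)"

lemma step_weight_nonneg: "step_weight U p u \<ge> 0"
  by (simp add: step_weight_def sum_nonneg start_freq_nonneg)

lemma sum_step_weight_le_1: "(\<Sum>u\<in>V. step_weight U p u) \<le> 1"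
proof (cases "p = []")
  case True
  have "(\<Sum>u\<in>V. step_weight U p u) = (\<Sum>u\<in>V - U. start_freq u / sum start_freq (V - U))"
    using True finite_V by (intro sum.mono_neutral_cong_right) (auto simp: step_weight_def)
  then show ?thesis by (simp add: sum_divide_distrib[symmetric])
next
  case False
  have "(\<Sum>u\<in>V. step_weight U p u) = (\<Sum>u\<in>nbrs (last p) - U. 1 / card (nbrs (last p) - U))"
    using False finite_V nbrs_subset by (intro sum.mono_neutral_cong_right) (auto simp: step_weight_def)
  then show ?thesis by simp
qed

text \<open>The product of the values of \<open>step_weight\<close> along a tiling, in closed form.\<close>

definition tiling_weight :: "(nat \<times> nat \<Rightarrow> 'v) \<Rightarrow> real" where
  "tiling_weight f = (\<Prod>j<t. start_freq (f (j, 0)) / sum start_freq (V - used f j) *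
     (\<Prod>i<k - 1. 1 / card (nbrs (f (j, i)) - used f j)))"

lemma used_notin:
  assumes "f \<in> tilings" "j < t" "i < k"
  shows "f (j, i) \<notin> used f j"
proof
  assume "f (j, i) \<in> used f j"
  then obtain j' i' where *: "f (j, i) = f (j', i')" "j' < j" "i' < k" by (auto simp: used_def)
  then show False using tiling_eq_iff[OF assms, of j' i'] assms(2) by simp
qed

lemma tiling_step:
  assumes "f \<in> tilings" "j < t" "Suc i < k"
  shows "f (j, Suc i) \<in> nbrs (f (j, i)) - used f j"
  using used_notin assms by (auto simp: nbrs_def tilings_def)

lemma tiling_weight_pos:
  assumes "f \<in> tilings"
  shows "tiling_weight f > 0"
  unfolding tiling_weight_def
proof (intro prod_pos ballI mult_pos_pos divide_pos_pos)
  fix j assume j: "j \<in> {..<t}"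
  then show "start_freq (f (j, 0)) > 0" using start_freq_pos assms by simp
  then show "sum start_freq (V - used f j) > 0"
    using used_notin[OF assms, of j 0] tiling_in_V[OF assms, of j 0] j k_ge_2 finite_V
    by (intro sum_pos2[of _ "f (j, 0)"]) (auto simp: start_freq_nonneg)
  fix i assume "i \<in> {..<k - 1}"
  then have "f (j, Suc i) \<in> nbrs (f (j, i)) - used f j" using tiling_step[OF assms, of j i] j by simp
  then show "real (card (nbrs (f (j, i)) - used f j)) > 0"
    using finite_nbrs by (auto simp: card_gt_0_iff)
qed simp

lemma sum_tiling_weight_le_1: "(\<Sum>f\<in>tilings. tiling_weight f) \<le> 1"
proof -
  let ?X = "{b. set b \<subseteq> V \<and> length b = k}"
  define w where "w p b = (\<Prod>i<k. step_weight (\<Union>(set ` set p)) (take i b) (b ! i))"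
    for p :: "'v list list" and b :: "'v list"
  define lst where "lst f = map (\<lambda>j. map (\<lambda>i. f (j, i)) [0..<k]) [0..<t]" for f :: "nat \<times> nat \<Rightarrow> 'v"
  have finX: "finite ?X" using finite_lists_length_eq[OF finite_V] by simp
  have w_sum: "(\<Sum>b\<in>?X. w p b) \<le> 1" for p
    unfolding w_def
    by (rule sum_sequential_weights_le_1) (auto simp: finite_V step_weight_nonneg sum_step_weight_le_1)
  have w_nonneg: "w p b \<ge> 0" for p b
    unfolding w_def by (intro prod_nonneg) (simp add: step_weight_nonneg)
  have inj: "inj_on lst tilings"
  proof (rule inj_onI)
    fix f g assume fg: "f \<in> tilings" "g \<in> tilings" "lst f = lst g"
    have "f (j, i) = g (j, i)" if "j < t" "i < k" for i j
    proof -
      have "lst f ! j ! i = lst g ! j ! i" using fg by simp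
      then show ?thesis using that by (simp add: lst_def)
    qed
    moreover have "f p = g p" if "p \<notin> D" for p
      using tiling_outside[OF fg(1) that] tiling_outside[OF fg(2) that] by (rule trans[OF _ sym])
    ultimately have "f p = g p" if "p = (j, i)" for p j i
      using that by (cases "p \<in> D") auto
    then have "f (j, i) = g (j, i)" for j i by blast
    then show "f = g" by (simp add: fun_eq_iff)
  qed
  have lst_in: "lst ` tilings \<subseteq> {xs. set xs \<subseteq> ?X \<and> length xs = t}"
    by (auto simp: lst_def tiling_in_V)
  have weight: "(\<Prod>j<t. w (take j (lst f)) (lst f ! j)) = tiling_weight f" if f: "f \<in> tilings" for f
    unfolding tiling_weight_def
  proof (intro prod.cong refl)
    fix j assume "j \<in> {..<t}"
    then have j: "j < t" by simp
    have "set (take j (lst f)) = (\<lambda>j. map (\<lambda>i. f (j, i)) [0..<k]) ` {..<j}"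
      using j by (auto simp: lst_def take_map)
    then have U: "\<Union>(set ` set (take j (lst f))) = used f j"
      by (auto simp: used_def)
    obtain k' where k': "k = Suc k'" using k_ge_2 by (cases k) auto
    have "w (take j (lst f)) (lst f ! j) =
        (\<Prod>i<k. step_weight (used f j) (take i (lst f ! j)) (f (j, i)))"
      unfolding w_def U using j by (intro prod.cong) (auto simp: lst_def)
    also have "\<dots> = step_weight (used f j) [] (f (j, 0)) *
        (\<Prod>i<k'. step_weight (used f j) (take (Suc i) (lst f ! j)) (f (j, Suc i)))"
      unfolding k' by (subst prod.lessThan_Suc_shift) simp
    also have "step_weight (used f j) [] (f (j, 0)) = start_freq (f (j, 0)) / sum start_freq (V - used f j)"
      using used_notin[OF f j] tiling_in_V[OF f j] k_ge_2 by (simp add: step_weight_def)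
    also have "(\<Prod>i<k'. step_weight (used f j) (take (Suc i) (lst f ! j)) (f (j, Suc i))) =
        (\<Prod>i<k'. 1 / card (nbrs (f (j, i)) - used f j))"
    proof (intro prod.cong refl)
      fix i assume "i \<in> {..<k'}"
      then have i: "Suc i < k" by (simp add: k')
      then have "take (Suc i) (lst f ! j) = map (\<lambda>i. f (j, i)) [0..<Suc i]"
        using j by (simp add: lst_def take_map del: upt_Suc)
      then show "step_weight (used f j) (take (Suc i) (lst f ! j)) (f (j, Suc i)) =
          1 / card (nbrs (f (j, i)) - used f j)"
        using tiling_step[OF f j i] by (simp add: step_weight_def)
    qed
    finally show "w (take j (lst f)) (lst f ! j) = start_freq (f (j, 0)) / sum start_freq (V - used f j) *
        (\<Prod>i<k - 1. 1 / card (nbrs (f (j, i)) - used f j))"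
      by (simp add: k')
  qed
  have "(\<Sum>f\<in>tilings. tiling_weight f) = (\<Sum>xs\<in>lst ` tilings. \<Prod>j<t. w (take j xs) (xs ! j))"
    by (simp add: sum.reindex[OF inj] weight)
  also have "\<dots> \<le> (\<Sum>xs | set xs \<subseteq> ?X \<and> length xs = t. \<Prod>j<t. w (take j xs) (xs ! j))"
    using finite_lists_length_eq[OF finX] lst_in
    by (intro sum_mono2) (auto intro!: prod_nonneg w_nonneg)
  also have "\<dots> \<le> 1"
    by (rule sum_sequential_weights_le_1[OF finX w_nonneg w_sum])
  finally show ?thesis .
qed

lemma bij_betw_unused:
  assumes "f \<in> tilings" "j \<le> t"
  shows "bij_betw f ({j..<t} \<times> {..<k}) (V - used f j)"
proof -
  have inj: "inj_on f D" and img: "f ` D = V" using tiling_bij[OF assms(1)] by (auto simp: bij_betw_def)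
  have D: "{j..<t} \<times> {..<k} = D - {..<j} \<times> {..<k}" using assms(2) by auto
  have "f ` (D - {..<j} \<times> {..<k}) = f ` D - f ` ({..<j} \<times> {..<k})"
    using assms(2) by (intro inj_on_image_set_diff[OF inj]) auto
  moreover have "inj_on f (D - {..<j} \<times> {..<k})" by (rule inj_on_subset[OF inj]) blast
  ultimately show ?thesis by (simp add: D bij_betw_def img used_def)
qed

lemma sum_unused:
  fixes h :: "'v \<Rightarrow> real"
  assumes "f \<in> tilings" "j \<le> t"
  shows "(\<Sum>v\<in>V - used f j. h v) = (\<Sum>b\<in>{j..<t}. \<Sum>i<k. h (f (b, i)))"
  using sum.reindex_bij_betw[OF bij_betw_unused[OF assms], of h]
  by (simp add: sum.cartesian_product)

text \<open>Exchanging two blocks preserves the set of tilings, so all blocks have the same expected mass. The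
  total mass of the \<open>t\<close> blocks is \<open>t\<close> in every tiling.\<close>

lemma sum_start_freq_block:
  assumes "b < t"
  shows "(\<Sum>f\<in>tilings. \<Sum>i<k. start_freq (f (b, i))) = M"
proof -
  let ?T = "\<lambda>b. \<Sum>f\<in>tilings. \<Sum>i<k. start_freq (f (b, i))"
  have "?T c = ?T b" if "c < t" for c
    using sum_tilings_swap[OF assms that, of "\<lambda>f. \<Sum>i<k. start_freq (f (b, i))"] by simp
  then have "t * ?T b = (\<Sum>c<t. ?T c)" by simp
  also have "\<dots> = (\<Sum>f\<in>tilings. \<Sum>c<t. \<Sum>i<k. start_freq (f (c, i)))" by (rule sum.swap)
  also have "\<dots> = M * t" by (simp add: sum_V_eq_sum_tiling[symmetric] sum_start_freq)
  finally show ?thesis using assms by simp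
qed

text \<open>Before block \<open>j\<close> the unused vertices have expected mass \<open>t - j\<close>; the product of these numbers is \<open>t!\<close>,
  which is the price for ordering the blocks.\<close>

lemma sum_ln_start_mass:
  "(\<Sum>f\<in>tilings. \<Sum>j<t. ln (sum start_freq (V - used f j))) \<le> M * ln (fact t)"
proof -
  have "(\<Sum>f\<in>tilings. ln (sum start_freq (V - used f j))) \<le> M * ln (t - j)" if j: "j < t" for j
  proof -
    let ?S = "\<lambda>f. sum start_freq (V - used f j)"
    have pos: "?S f > 0" if "f \<in> tilings" for f
      using used_notin[OF that j, of 0] tiling_in_V[OF that j, of 0] start_freq_pos[OF that j] k_ge_2 finite_V
      by (intro sum_pos2[of _ "f (j, 0)"]) (auto simp: start_freq_nonneg)
    have "(\<Sum>f\<in>tilings. ?S f) = (\<Sum>f\<in>tilings. \<Sum>b\<in>{j..<t}. \<Sum>i<k. start_freq (f (b, i)))"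
      using j by (intro sum.cong sum_unused) auto
    also have "\<dots> = (\<Sum>b\<in>{j..<t}. \<Sum>f\<in>tilings. \<Sum>i<k. start_freq (f (b, i)))" by (rule sum.swap)
    also have "\<dots> = (t - j) * M" using j by (simp add: sum_start_freq_block)
    finally have S: "(\<Sum>f\<in>tilings. ?S f) = (t - j) * M" .
    have "(\<Sum>f\<in>tilings. ln (?S f)) \<le> (\<Sum>f\<in>tilings. ln (t - j) + ?S f / (t - j) - 1)"
      using j by (intro sum_mono ln_le_tangent pos) auto
    also have "\<dots> = M * ln (t - j) + (\<Sum>f\<in>tilings. ?S f) / (t - j) - M"
      by (simp add: sum.distrib sum_subtractf sum_divide_distrib)
    also have "\<dots> = M * ln (t - j)" using j unfolding S by simp
    finally show ?thesis .
  qed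
  then have "(\<Sum>f\<in>tilings. \<Sum>j<t. ln (sum start_freq (V - used f j))) \<le> (\<Sum>j<t. M * ln (t - j))"
    by (subst sum.swap) (auto intro: sum_mono)
  also have "\<dots> = M * ln (\<Prod>j<t. real (t - j))"
    by (subst ln_prod) (auto simp: sum_distrib_left)
  also have "(\<Prod>j<t. real (t - j)) = fact t"
    by (simp add: fact_prod_rev atLeast0LessThan)
  finally show ?thesis .
qed

lemma sum_block_nbrs:
  assumes "f \<in> tilings" "j \<le> t"
  shows "(\<Sum>b\<in>{j..<t}. \<Sum>i<k. of_bool (f (b, i) \<in> nbrs v)) = real (card (nbrs v - used f j))"
proof -
  have "{u \<in> V - used f j. u \<in> nbrs v} = nbrs v - used f j" using nbrs_subset by auto
  then have "real (card (nbrs v - used f j)) = (\<Sum>u\<in>V - used f j. of_bool (u \<in> nbrs v))"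
    using sum.inter_filter[of "V - used f j" "\<lambda>_. 1 :: real" "\<lambda>u. u \<in> nbrs v"] finite_V
    by (simp add: of_bool_def)
  then show ?thesis using sum_unused[OF assms, of "\<lambda>u. of_bool (u \<in> nbrs v)"] by simp
qed

text \<open>Exchanging two blocks other than \<open>j\<close> fixes the vertex \<open>f (j, i)\<close>. So each of these \<open>t - 1\<close> blocks
  contains, in expectation, the same share of its neighbours, at most \<open>deg / (t - 1)\<close>, and \<open>t - 1 - j\<close>
  of these blocks are still unused. Block \<open>j\<close> itself contributes at most \<open>k\<close>. The weight \<open>1 / c (f (j, i))\<close>
  stands inside the sum because the degree of this vertex depends on \<open>f\<close>.\<close>

lemma sum_available_le:
  assumes t: "t \<ge> 2" and j: "j < t" and i: "i < k" and c: "\<And>v. c v > 0"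
    and le: "\<And>v. (t - 1 - j) / (t - 1) * deg v + k \<le> c v"
  shows "(\<Sum>f\<in>tilings. card (nbrs (f (j, i)) - used f j) / c (f (j, i))) \<le> M"
proof -
  define a where "a f b = (\<Sum>i'<k. of_bool (f (b, i') \<in> nbrs (f (j, i)))) / c (f (j, i))"
    for f and b :: nat
  define A where "A b = (\<Sum>f\<in>tilings. a f b)" for b
  define B where "B = (\<Sum>f\<in>tilings. deg (f (j, i)) / c (f (j, i)))"
  have a_nonneg: "a f b \<ge> 0" for f b
    unfolding a_def using c by (intro divide_nonneg_pos sum_nonneg) auto
  have sum_a: "(\<Sum>b\<in>{j'..<t}. a f b) = card (nbrs (f (j, i)) - used f j') / c (f (j, i))"
    if "f \<in> tilings" "j' \<le> t" for f j'
    using sum_block_nbrs[OF that, of "f (j, i)"] by (simp add: a_def sum_divide_distrib[symmetric])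
  have swap: "A b = A b'" if "b < t" "b' < t" "b \<noteq> j" "b' \<noteq> j" for b b'
  proof -
    have "transpose b b' j = j" using that by (simp add: transpose_def)
    then have swapped: "a (f \<circ> map_prod (transpose b b') id) b = a f b'" for f
      by (simp add: a_def)
    show ?thesis
      unfolding A_def sum_tilings_swap[of b b' "\<lambda>f. a f b", OF that(1,2)] swapped ..
  qed
  have A_le: "A b \<le> B / (t - 1)" if b: "b < t" "b \<noteq> j" for b
  proof -
    have "real (t - 1) * A b = (\<Sum>b'\<in>{..<t} - {j}. A b)" using j by simp
    also have "\<dots> = (\<Sum>b'\<in>{..<t} - {j}. A b')" using b by (intro sum.cong refl swap) auto
    also have "\<dots> \<le> (\<Sum>b'<t. A b')"
      using a_nonneg by (intro sum_mono2) (auto simp: A_def sum_nonneg)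
    also have "\<dots> = (\<Sum>f\<in>tilings. \<Sum>b\<in>{0..<t}. a f b)"
      unfolding A_def atLeast0LessThan by (rule sum.swap)
    also have "\<dots> = B"
      unfolding B_def by (intro sum.cong refl) (simp add: sum_a used_def)
    finally show ?thesis using t by (simp add: pos_le_divide_eq mult.commute)
  qed
  have A_j: "A j \<le> (\<Sum>f\<in>tilings. k / c (f (j, i)))"
    unfolding A_def a_def
  proof (intro sum_mono divide_right_mono)
    fix f show "(\<Sum>i'<k. of_bool (f (j, i') \<in> nbrs (f (j, i)))) \<le> real k"
      using sum_bounded_above[of "{..<k}" "\<lambda>i'. of_bool (f (j, i') \<in> nbrs (f (j, i)))" "1::real"] by simp
  qed (use c in \<open>auto intro: less_imp_le\<close>)
  have "(\<Sum>f\<in>tilings. card (nbrs (f (j, i)) - used f j) / c (f (j, i))) = (\<Sum>f\<in>tilings. \<Sum>b\<in>{j..<t}. a f b)"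
    using j by (intro sum.cong) (auto simp: sum_a)
  also have "\<dots> = (\<Sum>b\<in>{j..<t}. A b)" unfolding A_def by (rule sum.swap)
  also have "\<dots> = A j + (\<Sum>b\<in>{Suc j..<t}. A b)" using j by (simp add: sum.atLeast_Suc_lessThan)
  also have "\<dots> \<le> (\<Sum>f\<in>tilings. k / c (f (j, i))) + (\<Sum>b\<in>{Suc j..<t}. B / (t - 1))"
    using A_j by (intro add_mono sum_mono A_le) auto
  also have "(\<Sum>b\<in>{Suc j..<t}. B / (t - 1)) = (t - 1 - j) / (t - 1) * B"
    using j by simp
  also have "\<dots> = (\<Sum>f\<in>tilings. (t - 1 - j) / (t - 1) * deg (f (j, i)) / c (f (j, i)))"
    by (simp only: B_def sum_distrib_left times_divide_eq_right)
  also have "(\<Sum>f\<in>tilings. k / c (f (j, i))) + \<dots> =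
      (\<Sum>f\<in>tilings. ((t - 1 - j) / (t - 1) * deg (f (j, i)) + k) / c (f (j, i)))"
    by (simp only: sum.distrib[symmetric] add_divide_distrib[symmetric] add.commute)
  also have "\<dots> \<le> (\<Sum>f\<in>tilings. 1)"
    using le c by (intro sum_mono) (simp add: divide_le_eq_1)
  finally show ?thesis by simp
qed

lemma sum_ln_available_le:
  assumes t: "t \<ge> 2" and j: "j < t" and c: "\<And>v. c v > 0"
    and le: "\<And>v. (t - 1 - j) / (t - 1) * deg v + k \<le> c v" and i: "Suc i < k"
  shows "(\<Sum>f\<in>tilings. ln (card (nbrs (f (j, i)) - used f j))) \<le> (\<Sum>f\<in>tilings. ln (c (f (j, i))))"
proof -
  have pos: "real (card (nbrs (f (j, i)) - used f j)) > 0" if "f \<in> tilings" for f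
    using tiling_step[OF that j i] finite_nbrs by (auto simp: card_gt_0_iff)
  have "(\<Sum>f\<in>tilings. ln (card (nbrs (f (j, i)) - used f j))) \<le>
      (\<Sum>f\<in>tilings. ln (c (f (j, i))) + card (nbrs (f (j, i)) - used f j) / c (f (j, i)) - 1)"
    using c by (intro sum_mono ln_le_tangent pos)
  also have "\<dots> = (\<Sum>f\<in>tilings. ln (c (f (j, i)))) +
      (\<Sum>f\<in>tilings. card (nbrs (f (j, i)) - used f j) / c (f (j, i))) - M"
    by (simp add: sum.distrib sum_subtractf)
  also have "\<dots> \<le> (\<Sum>f\<in>tilings. ln (c (f (j, i))))"
    using sum_available_le[OF t j _ c le] i by simp
  finally show ?thesis .
qed


text \<open>The entropy bound. The function \<open>d'\<close> is an enlarged degree and \<open>lam j\<close> is, up to a small error, the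
  fraction of neighbours that are still available when block \<open>j\<close> is revealed.\<close>

lemma ln_card_tilings_le:
  fixes d' :: "'v \<Rightarrow> real"
  assumes t: "t \<ge> 2" and d': "\<And>v. d' v > 0" and lam: "\<And>j. j < t \<Longrightarrow> lam j > 0"
    and le: "\<And>v j. j < t \<Longrightarrow> (t - 1 - j) / (t - 1) * deg v + k \<le> d' v * lam j"
  shows "ln M \<le> ln (fact t) + (\<Sum>v\<in>V. (1 - start_freq v) * ln (d' v) - start_freq v * ln (start_freq v))
    + (k - 1) * (\<Sum>j<t. ln (lam j))"
proof -
  let ?W = "\<lambda>f j. \<Sum>i<k - 1. ln (card (nbrs (f (j, i)) - used f j))"
  have minus_ln: "- ln (tiling_weight f) = (\<Sum>j<t. ln (sum start_freq (V - used f j))) -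
      (\<Sum>j<t. ln (start_freq (f (j, 0)))) + (\<Sum>j<t. ?W f j)" if f: "f \<in> tilings" for f
  proof -
    have S: "sum start_freq (V - used f j) > 0" if "j < t" for j
      using used_notin[OF f that, of 0] tiling_in_V[OF f that, of 0] start_freq_pos[OF f that] k_ge_2 finite_V
      by (intro sum_pos2[of _ "f (j, 0)"]) (auto simp: start_freq_nonneg)
    have card: "card (nbrs (f (j, i)) - used f j) > 0" if "j < t" "i < k - 1" for i j
    proof -
      have "Suc i < k" using that by simp
      then show ?thesis
        using tiling_step[OF f that(1), of i] finite_nbrs by (auto simp: card_gt_0_iff)
    qed
    have "ln (tiling_weight f) = (\<Sum>j<t. ln (start_freq (f (j, 0)) / sum start_freq (V - used f j) *
        (\<Prod>i<k - 1. 1 / card (nbrs (f (j, i)) - used f j))))"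
      unfolding tiling_weight_def using S[THEN less_imp_neq] card start_freq_pos[OF f, THEN less_imp_neq]
      by (intro ln_prod) fastforce+
    also have "\<dots> = (\<Sum>j<t. ln (start_freq (f (j, 0))) - ln (sum start_freq (V - used f j)) - ?W f j)"
    proof (intro sum.cong refl)
      fix j assume "j \<in> {..<t}"
      then have j: "j < t" by simp
      let ?P = "\<Prod>i<k - 1. 1 / real (card (nbrs (f (j, i)) - used f j))"
      have ln_P: "ln ?P = - ?W f j"
        using card[OF j] by (subst ln_prod) (auto simp: ln_div sum_negf)
      have P: "?P > 0"
        using card[OF j] by (intro prod_pos) auto
      have "ln (start_freq (f (j, 0)) / sum start_freq (V - used f j) * ?P) =
          ln (start_freq (f (j, 0)) / sum start_freq (V - used f j)) - ?W f j"
        unfolding ln_mult_pos[OF divide_pos_pos[OF start_freq_pos[OF f j] S[OF j]] P] ln_P by simp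
      then show "ln (start_freq (f (j, 0)) / sum start_freq (V - used f j) *
          (\<Prod>i<k - 1. 1 / card (nbrs (f (j, i)) - used f j))) =
          ln (start_freq (f (j, 0))) - ln (sum start_freq (V - used f j)) - ?W f j"
        using S[OF j] start_freq_pos[OF f j] by (simp only: ln_divide_pos)
    qed
    finally show ?thesis by (simp add: sum_subtractf)
  qed
  have steps: "(\<Sum>f\<in>tilings. \<Sum>j<t. ?W f j) \<le>
      M * (\<Sum>v\<in>V. (1 - start_freq v) * ln (d' v)) + M * ((k - 1) * (\<Sum>j<t. ln (lam j)))"
  proof -
    have "(\<Sum>f\<in>tilings. \<Sum>j<t. ?W f j) =
        (\<Sum>j<t. \<Sum>i<k - 1. \<Sum>f\<in>tilings. ln (card (nbrs (f (j, i)) - used f j)))"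
      by (subst sum.swap) (intro sum.cong refl sum.swap)
    also have "\<dots> \<le> (\<Sum>j<t. \<Sum>i<k - 1. \<Sum>f\<in>tilings. ln (d' (f (j, i)) * lam j))"
    proof (rule sum_mono, rule sum_mono)
      fix j i assume "j \<in> {..<t}" "i \<in> {..<k - 1}"
      then have "j < t" "i < k" "Suc i < k" by auto
      then show "(\<Sum>f\<in>tilings. ln (card (nbrs (f (j, i)) - used f j))) \<le>
          (\<Sum>f\<in>tilings. ln (d' (f (j, i)) * lam j))"
        using t lam d' le by (intro sum_ln_available_le[where c = "\<lambda>v. d' v * lam j"]) auto
    qed
    also have "\<dots> = (\<Sum>j<t. \<Sum>i<k - 1. \<Sum>f\<in>tilings. ln (d' (f (j, i))) + ln (lam j))"
      using d' lam by (intro sum.cong refl ln_mult_pos) auto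
    also have "\<dots> = (\<Sum>j<t. \<Sum>i<k - 1. \<Sum>f\<in>tilings. ln (d' (f (j, i)))) + M * ((k - 1) * (\<Sum>j<t. ln (lam j)))"
      by (simp add: sum.distrib sum_distrib_left mult_ac)
    also have "(\<Sum>j<t. \<Sum>i<k - 1. \<Sum>f\<in>tilings. ln (d' (f (j, i)))) =
        (\<Sum>f\<in>tilings. \<Sum>j<t. \<Sum>i<k - 1. ln (d' (f (j, i))))"
      by (subst sum.swap[of _ _ tilings]) (intro sum.cong refl sum.swap)
    also have "\<dots> = (\<Sum>f\<in>tilings. (\<Sum>v\<in>V. ln (d' v)) - (\<Sum>j<t. ln (d' (f (j, k - 1)))))"
    proof (intro sum.cong refl)
      fix f assume f: "f \<in> tilings"
      obtain k' where k': "k = Suc k'" using k_ge_2 by (cases k) auto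
      show "(\<Sum>j<t. \<Sum>i<k - 1. ln (d' (f (j, i)))) =
          (\<Sum>v\<in>V. ln (d' v)) - (\<Sum>j<t. ln (d' (f (j, k - 1))))"
        using sum_V_eq_sum_tiling[OF f, of "\<lambda>v. ln (d' v)"] by (simp add: k' sum.distrib)
    qed
    also have "\<dots> = M * (\<Sum>v\<in>V. ln (d' v)) - M * (\<Sum>v\<in>V. start_freq v * ln (d' v))"
      by (simp add: sum_subtractf sum_ends[of "\<lambda>v. ln (d' v)", unfolded One_nat_def])
    also have "\<dots> = M * (\<Sum>v\<in>V. (1 - start_freq v) * ln (d' v))"
      by (simp add: sum_subtractf left_diff_distrib right_diff_distrib)
    finally show ?thesis .
  qed
  have "M * ln M \<le> (\<Sum>f\<in>tilings. - ln (tiling_weight f))"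
    by (intro card_ln_card_le_sum_minus_ln finite_tilings tiling_weight_pos sum_tiling_weight_le_1)
  also have "\<dots> = (\<Sum>f\<in>tilings. \<Sum>j<t. ln (sum start_freq (V - used f j))) -
      (\<Sum>f\<in>tilings. \<Sum>j<t. ln (start_freq (f (j, 0)))) + (\<Sum>f\<in>tilings. \<Sum>j<t. ?W f j)"
    by (simp add: minus_ln sum.distrib sum_subtractf)
  also have "\<dots> \<le> M * ln (fact t) - M * (\<Sum>v\<in>V. start_freq v * ln (start_freq v)) +
      (M * (\<Sum>v\<in>V. (1 - start_freq v) * ln (d' v)) + M * ((k - 1) * (\<Sum>j<t. ln (lam j))))"
    using sum_ln_start_mass steps sum_starts[of "\<lambda>v. ln (start_freq v)"] by simp
  also have "\<dots> = M * (ln (fact t) + (\<Sum>v\<in>V. (1 - start_freq v) * ln (d' v) - start_freq v * ln (start_freq v))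
    + (k - 1) * (\<Sum>j<t. ln (lam j)))"
    by (simp only: sum_subtractf distrib_left right_diff_distrib)
  finally show ?thesis using M_pos by (simp only: mult_le_cancel_left_pos)
qed

end

section \<open>Regular degrees are extremal\<close>

text \<open>The left-hand side vanishes at \<open>s = 1 / K\<close>, where its derivative is \<open>- 2\<close>. It is concave
  on \<open>[0, 1 / 2]\<close>, so it stays below its tangent there; beyond \<open>1 / 2\<close> it is convex.\<close>

lemma start_entropy_le_tangent:
  fixes K s :: real
  assumes K: "K \<ge> 2" and s: "0 \<le> s" "s \<le> 1 / 2"
  shows "(1 - s) * ln ((1 - s) * K / (K - 1)) - s * ln (K * s) \<le> - 2 * (s - 1 / K)"
proof (cases "s = 0")
  case True
  have "K / (K - 1) = 1 + 1 / (K - 1)" using K by (simp add: field_simps)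
  then have "ln (K / (K - 1)) \<le> 1 / (K - 1)" using K by (simp add: ln_add_one_self_le_self)
  also have "\<dots> \<le> 2 / K" using K by (simp add: field_simps)
  finally show ?thesis using True by simp
next
  case False
  then have s0: "s > 0" using s by simp
  define \<phi> where "\<phi> x = (1 - x) * ln ((1 - x) * K / (K - 1)) - x * ln (K * x) + 2 * (x - 1 / K)" for x
  have deriv: "(\<phi> has_real_derivative - ln (x * (1 - x) * K\<^sup>2 / (K - 1))) (at x)"
    if "0 < x" "x < 1" for x
  proof -
    have "ln (x * (1 - x) * K\<^sup>2 / (K - 1)) = ln ((1 - x) * K / (K - 1)) + ln (K * x)"
      using that K by (subst ln_mult_pos[symmetric]) (auto simp: power2_eq_square mult_ac)
    then show ?thesis
      unfolding \<phi>_def using that K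
      by (auto intro!: derivative_eq_intros simp: divide_simps) (simp add: algebra_simps)
  qed
  \<comment> \<open>The derivative changes its sign where \<open>x * (1 - x) * K\<^sup>2 = K - 1\<close>, that is, at \<open>1 / K\<close> and \<open>1 - 1 / K \<ge> 1 / 2\<close>.\<close>
  have factor: "K - 1 - x * (1 - x) * K\<^sup>2 = (1 - K * x) * (K - 1 - K * x)" for x
    by (simp add: algebra_simps power2_eq_square)
  have \<phi>0: "\<phi> (1 / K) = 0" using K by (simp add: \<phi>_def field_simps)
  have "\<phi> s \<le> \<phi> (1 / K)"
  proof (cases "s \<le> 1 / K")
    case True
    show ?thesis
    proof (rule DERIV_nonneg_imp_nondecreasing[OF True])
      fix x assume x: "s \<le> x" "x \<le> 1 / K"
      have "K * x \<le> 1" using x K by (simp add: field_simps)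
      then have "K - 1 - x * (1 - x) * K\<^sup>2 \<ge> 0"
        unfolding factor using K by (intro mult_nonneg_nonneg) auto
      moreover have "1 / K < 1" using K by simp
      then have "0 < x" "x < 1" using x s0 by linarith+
      ultimately show "\<exists>y. (\<phi> has_real_derivative y) (at x) \<and> 0 \<le> y"
        using deriv[of x] K by (intro exI[of _ "- ln (x * (1 - x) * K\<^sup>2 / (K - 1))"]) simp
    qed
  next
    case False
    then have le: "1 / K \<le> s" by simp
    show ?thesis
    proof (rule DERIV_nonpos_imp_nonincreasing[OF le])
      fix x assume x: "1 / K \<le> x" "x \<le> s"
      have "K * x \<ge> 1" using x K by (simp add: field_simps)
      moreover have "K * x \<le> K - 1"
      proof -
        have "K * x \<le> K * (1 / 2)" using x s K by (intro mult_left_mono) auto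
        also have "K * (1 / 2) \<le> K - 1" using K by simp
        finally show ?thesis .
      qed
      ultimately have "K - 1 - x * (1 - x) * K\<^sup>2 \<le> 0"
        unfolding factor by (intro mult_nonpos_nonneg) auto
      moreover have "0 < 1 / K" using K by simp
      then have "0 < x" "x < 1" using x s by linarith+
      ultimately show "\<exists>y. (\<phi> has_real_derivative y) (at x) \<and> y \<le> 0"
        using deriv[of x] K by (intro exI[of _ "- ln (x * (1 - x) * K\<^sup>2 / (K - 1))"]) simp
    qed
  qed
  then show ?thesis unfolding \<phi>0 by (simp add: \<phi>_def)
qed

text \<open>Both sides agree when \<open>s = 1 / K\<close> and \<open>d = B\<close> are constant. The proof bounds each summand by a function that is
  linear in \<open>s v\<close> and \<open>d v\<close> and touches it there, and then uses that both have prescribed sums.\<close>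

lemma sum_entropy_ln_le:
  fixes s d :: "'v \<Rightarrow> real" and K B :: real
  assumes K: "K \<ge> 2" and s: "\<And>v. v \<in> V \<Longrightarrow> 0 \<le> s v \<and> s v \<le> 1 / 2" and d: "\<And>v. v \<in> V \<Longrightarrow> d v > 0"
    and sum_s: "(\<Sum>v\<in>V. s v) = card V / K" and sum_d: "(\<Sum>v\<in>V. d v) \<le> card V * B" and B: "B > 0"
  shows "(\<Sum>v\<in>V. (1 - s v) * ln (d v) - s v * ln (s v)) \<le> card V / K * ln K + card V * (1 - 1 / K) * ln B"
proof -
  have "(\<Sum>v\<in>V. (1 - s v) * ln (d v) - s v * ln (s v)) \<le>
      (\<Sum>v\<in>V. s v * ln K + (1 - s v) * ln B + (1 - 1 / K) / B * d v - (1 - s v) - 2 * (s v - 1 / K))"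
  proof (rule sum_mono)
    fix v assume v: "v \<in> V"
    \<comment> \<open>For fixed \<open>s v\<close>, the best degree is proportional to \<open>1 - s v\<close>; this is the point of tangency.\<close>
    define c where "c = B * ((1 - s v) * K / (K - 1))"
    have s1: "1 - s v > 0" using s[OF v] by auto
    then have c: "c > 0" and q: "(1 - s v) * K / (K - 1) > 0"
      using K B by (auto simp: c_def intro!: mult_pos_pos divide_pos_pos)
    have "(1 - s v) * ln (d v) \<le> (1 - s v) * (ln c + d v / c - 1)"
      using s1 c d[OF v] by (intro mult_left_mono) (use ln_le_tangent in auto)
    also have "\<dots> = (1 - s v) * ln B + (1 - s v) * ln ((1 - s v) * K / (K - 1)) + (1 - 1 / K) / B * d v - (1 - s v)"
    proof -
      have "ln c = ln B + ln ((1 - s v) * K / (K - 1))"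
        unfolding c_def using B q by (rule ln_mult_pos)
      moreover have "(1 - s v) * (d v / c) = (1 - 1 / K) / B * d v"
        using s1 K B by (simp add: c_def field_simps)
      ultimately show ?thesis by (simp add: algebra_simps)
    qed
    finally have "(1 - s v) * ln (d v) \<le> (1 - s v) * ln B + (1 - s v) * ln ((1 - s v) * K / (K - 1))
      + (1 - 1 / K) / B * d v - (1 - s v)" .
    moreover have "s v * ln (K * s v) = s v * ln K + s v * ln (s v)"
    proof (cases "s v = 0")
      case False
      then have "s v > 0" using s[OF v] by auto
      then show ?thesis using K by (simp add: ln_mult_pos algebra_simps)
    qed simp
    moreover have "(1 - s v) * ln ((1 - s v) * K / (K - 1)) - s v * ln (K * s v) \<le> - 2 * (s v - 1 / K)"
      using start_entropy_le_tangent[OF K] s[OF v] by blast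
    ultimately show "(1 - s v) * ln (d v) - s v * ln (s v) \<le>
        s v * ln K + (1 - s v) * ln B + (1 - 1 / K) / B * d v - (1 - s v) - 2 * (s v - 1 / K)"
      by linarith
  qed
  also have "\<dots> = card V / K * ln K + (card V - card V / K) * ln B
      + (1 - 1 / K) / B * (\<Sum>v\<in>V. d v) - (card V - card V / K)"
    by (simp only: sum.distrib sum_subtractf sum_distrib_left[symmetric] sum_distrib_right[symmetric] sum_s)
      (simp add: algebra_simps)
  also have "\<dots> \<le> card V / K * ln K + (card V - card V / K) * ln B
      + (1 - 1 / K) / B * (card V * B) - (card V - card V / K)"
    using K B by (intro add_mono diff_mono mult_left_mono sum_d order_refl) auto
  also have "\<dots> = card V / K * ln K + card V * (1 - 1 / K) * ln B"
  proof -
    have "(1 - 1 / K) / B * (card V * B) = card V - card V / K" using B by (simp add: field_simps)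
    then show ?thesis by (simp add: algebra_simps)
  qed
  finally show ?thesis .
qed

text \<open>The error per step that comes from enlarging the available fraction by \<open>\<rho>\<close>. Up to the leading term \<open>- 1\<close> it is
  the integral of \<open>ln (x + \<rho>)\<close> over \<open>[0, 1]\<close>, written with the antiderivative \<open>x * ln x - x\<close>.\<close>

definition excess :: "real \<Rightarrow> real" where
  "excess \<rho> = (1 + \<rho>) * ln (1 + \<rho>) - \<rho> * ln \<rho>"

text \<open>A discrete form of \<open>ln x \<le> \<integral> ln\<close> over \<open>[x, x + 1]\<close>; summed over \<open>x\<close> it telescopes.\<close>

lemma ln_le_diff_x_ln_x:
  fixes x :: real
  assumes "x > 0"
  shows "ln x \<le> ((x + 1) * ln (x + 1) - (x + 1)) - (x * ln x - x)"
proof -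
  have "ln (x / (x + 1)) \<le> x / (x + 1) - 1"
    using assms by (intro ln_le_minus_one) simp
  also have "\<dots> = - 1 / (x + 1)" using assms by (simp add: field_simps)
  finally have "(x + 1) * (ln x - ln (x + 1)) \<le> - 1"
    using assms by (simp add: ln_div field_simps)
  then show ?thesis by (simp add: algebra_simps)
qed

lemma sum_ln_shift_le:
  fixes x :: real
  assumes "x > 0"
  shows "(\<Sum>i<t. ln (real i + x)) \<le> ((real t + x) * ln (real t + x) - (real t + x)) - (x * ln x - x)"
proof -
  have "(\<Sum>i<t. ln (real i + x)) \<le> (\<Sum>i<t. ((real (Suc i) + x) * ln (real (Suc i) + x) - (real (Suc i) + x))
      - ((real i + x) * ln (real i + x) - (real i + x)))"
    using assms ln_le_diff_x_ln_x[of "real _ + x"] by (intro sum_mono) (simp add: add_ac)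
  also have "\<dots> = ((real t + x) * ln (real t + x) - (real t + x)) - (x * ln x - x)"
    by (subst sum_lessThan_telescope) simp
  finally show ?thesis .
qed

lemma sum_ln_fraction_le:
  assumes t: "t > 0" and \<rho>: "\<rho> > 0"
  shows "(\<Sum>j<t. ln (real (t - 1 - j) / real t + \<rho>)) \<le> t * (excess \<rho> - 1)"
proof -
  have "(\<Sum>j<t. ln (real (t - 1 - j) / real t + \<rho>)) = (\<Sum>i<t. ln (real i / real t + \<rho>))"
    using sum.nat_diff_reindex[of "\<lambda>i. ln (real i / real t + \<rho>)" t] by simp
  also have "\<dots> = (\<Sum>i<t. ln (real i + \<rho> * t) - ln t)"
  proof (intro sum.cong refl)
    fix i
    have "real i / real t + \<rho> = (real i + \<rho> * t) / t" using t by (simp add: field_simps)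
    moreover have "real i + \<rho> * t > 0" using t \<rho> by (simp add: add_nonneg_pos)
    ultimately show "ln (real i / real t + \<rho>) = ln (real i + \<rho> * t) - ln t"
      using t by (simp add: ln_div)
  qed
  also have "\<dots> \<le> ((t + \<rho> * t) * ln (t + \<rho> * t) - (t + \<rho> * t)) - (\<rho> * t * ln (\<rho> * t) - \<rho> * t) - t * ln t"
    using sum_ln_shift_le[of "\<rho> * t" t] t \<rho> by (simp add: sum_subtractf)
  also have "\<dots> = t * (excess \<rho> - 1)"
  proof -
    have "ln (t + \<rho> * t) = ln t + ln (1 + \<rho>)"
      using t \<rho> by (subst ln_mult_pos[symmetric]) (auto simp: algebra_simps)
    moreover have "ln (\<rho> * t) = ln \<rho> + ln t" using t \<rho> by (simp add: ln_mult_pos)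
    ultimately show ?thesis by (simp add: excess_def algebra_simps)
  qed
  finally show ?thesis .
qed

lemma tendsto_excess: "(excess \<longlongrightarrow> 0) (at_right 0)"
proof -
  have "((\<lambda>x::real. x * ln x) \<longlongrightarrow> 0) (at_right 0)"
  proof -
    have "((\<lambda>x::real. - (ln (inverse x) / inverse x)) \<longlongrightarrow> - 0) (at_right 0)"
      by (intro tendsto_minus filterlim_compose[OF ln_x_over_x_tendsto_0] filterlim_inverse_at_top_right)
    moreover have "eventually (\<lambda>x::real. - (ln (inverse x) / inverse x) = x * ln x) (at_right 0)"
      using eventually_at_right_less[of 0] by eventually_elim (simp add: ln_inverse divide_inverse)
    ultimately show ?thesis by (simp add: filterlim_cong)
  qed
  moreover have "((\<lambda>x::real. (1 + x) * ln (1 + x)) \<longlongrightarrow> (1 + 0) * ln (1 + 0)) (at_right 0)"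
    by (intro tendsto_intros) auto
  ultimately show ?thesis
    unfolding excess_def using tendsto_diff by fastforce
qed


context path_tilings
begin

text \<open>Adding \<open>D0\<close> to all degrees absorbs the summand \<open>k\<close> of \<open>ln_card_tilings_le\<close>, and \<open>2 \<le> \<rho> * t\<close> absorbs the
  difference between \<open>(t - 1 - j) / (t - 1)\<close> and \<open>(t - 1 - j) / t\<close>.\<close>

lemma card_tilings_le:
  fixes \<rho> D0 B :: real
  assumes card_V: "card V = k * t" and t: "t \<ge> 2" and \<rho>: "\<rho> > 0" "2 \<le> \<rho> * t"
    and D0: "D0 > 0" "2 * k \<le> \<rho> * D0" and B: "(\<Sum>v\<in>V. deg v + D0) \<le> card V * B"
  shows "card tilings \<le> fact t * k ^ t * (B * exp (excess \<rho> - 1)) ^ ((k - 1) * t)"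
proof -
  have "(\<Sum>v\<in>V. deg v + D0) > 0"
  proof (rule sum_pos)
    show "V \<noteq> {}" using card_V t k_ge_2 by auto
  qed (use finite_V D0 in \<open>auto intro: add_nonneg_pos\<close>)
  with B have "0 < card V * B" by linarith
  then have B0: "B > 0" by (simp add: zero_less_mult_iff)
  show ?thesis
  proof (cases "tilings = {}")
    case True
    then show ?thesis using B0 by simp
  next
    case False
    then interpret nonempty_path_tilings V E k t by unfold_locales
    define d' where "d' v = deg v + D0" for v
    define lam where "lam j = real (t - 1 - j) / real t + \<rho>" for j
    have le: "(t - 1 - j) / (t - 1) * deg v + k \<le> d' v * lam j" if j: "j < t" for v j
    proof -
      have "real (t - 1 - j) * t \<le> (real (t - 1 - j) + 1) * (t - 1)"
        using j t by (simp add: algebra_simps of_nat_diff)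
      then have "(t - 1 - j) / (t - 1) \<le> (real (t - 1 - j) + 1) / t"
        using t by (simp add: frac_le_eq divide_simps)
      also have "\<dots> = real (t - 1 - j) / t + 1 / t" by (simp add: add_divide_distrib)
      also have "1 / t \<le> \<rho> / 2" using \<rho> t by (simp add: field_simps)
      finally have "(t - 1 - j) / (t - 1) * deg v \<le> (real (t - 1 - j) / t + \<rho> / 2) * d' v"
        using D0 \<rho> by (intro mult_mono) (auto simp: d'_def)
      moreover have "real k \<le> \<rho> / 2 * d' v"
      proof -
        have "0 \<le> \<rho> * deg v" using \<rho> by simp
        then show ?thesis using D0 by (simp add: d'_def algebra_simps)
      qed
      ultimately show ?thesis by (simp add: lam_def algebra_simps)
    qed
    have "ln M \<le> ln (fact t) + (\<Sum>v\<in>V. (1 - start_freq v) * ln (d' v) - start_freq v * ln (start_freq v))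
        + (k - 1) * (\<Sum>j<t. ln (lam j))"
      using D0 \<rho> le by (intro ln_card_tilings_le t) (auto simp: d'_def lam_def intro: add_nonneg_pos)
    also have "\<dots> \<le> ln (fact t) + (t * ln k + ((k - 1) * t) * ln B) + (k - 1) * (t * (excess \<rho> - 1))"
    proof (intro add_mono mult_left_mono order_refl)
      have "(\<Sum>v\<in>V. (1 - start_freq v) * ln (d' v) - start_freq v * ln (start_freq v)) \<le>
          card V / k * ln k + card V * (1 - 1 / k) * ln B"
        using k_ge_2 D0 B B0 card_V
        by (intro sum_entropy_ln_le)
          (auto simp: start_freq_nonneg start_freq_le_half[simplified] sum_start_freq d'_def intro: add_nonneg_pos)
      also have "card V / k = t" using card_V k_ge_2 by simp
      also have "card V * (1 - 1 / k) = (k - 1) * t"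
        using card_V k_ge_2 by (simp add: field_simps of_nat_diff)
      finally show "(\<Sum>v\<in>V. (1 - start_freq v) * ln (d' v) - start_freq v * ln (start_freq v)) \<le>
          t * ln k + ((k - 1) * t) * ln B" by simp
      show "(\<Sum>j<t. ln (lam j)) \<le> t * (excess \<rho> - 1)"
        unfolding lam_def using t \<rho> by (intro sum_ln_fraction_le) auto
    qed simp
    also have "\<dots> = ln (fact t * k ^ t * (B * exp (excess \<rho> - 1)) ^ ((k - 1) * t))"
      using B0 k_ge_2 by (simp add: ln_mult ln_realpow algebra_simps)
    finally show ?thesis
      using M_pos B0 k_ge_2 by (subst (asm) ln_le_cancel_iff) auto
  qed
qed

end

section \<open>A Hamiltonian path\<close>

text \<open>The offset \<open>s\<close> is there because the path constructed below needs its cycles to start at prescribed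
  vertices. For \<open>l = 2\<close> the cycle is a single edge that is traversed
  back and forth.\<close>

lemma cycle_enumeration:
  assumes "simple_graph A" "graph_iso A (cycle_graph l)" "l > 0"
  obtains c where "\<And>i. {c i, c (Suc i)} \<in> edges A" "\<And>s. bij_betw (\<lambda>i. c (s + i)) {..<l} (verts A)"
    "\<And>i. c (i + l) = c i"
proof -
  obtain f where f: "bij_betw f (verts A) {..<l}" "(\<lambda>e. f ` e) ` edges A = edges (cycle_graph l)"
    using assms(2) by (auto simp: graph_iso_def cycle_graph_def)
  define g where "g = inv_into (verts A) f"
  have g: "bij_betw g {..<l} (verts A)" unfolding g_def using f(1) by (rule bij_betw_inv_into)
  define c where "c i = g (i mod l)" for i
  have "bij_betw (\<lambda>i. c (s + i)) {..<l} (verts A)" for s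
  proof -
    have inj: "inj_on (\<lambda>i. (s + i) mod l) {..<l}"
    proof (rule linorder_inj_onI)
      fix i j assume ij: "i < j" "i \<in> {..<l}" "j \<in> {..<l}"
      show "(s + i) mod l \<noteq> (s + j) mod l"
      proof
        assume "(s + i) mod l = (s + j) mod l"
        then have "l dvd (s + j) - (s + i)"
          using ij by (metis add_le_cancel_left less_imp_le mod_eq_dvd_iff_nat)
        then show False using ij by (auto dest: dvd_imp_le)
      qed
    qed auto
    moreover have "(\<lambda>i. (s + i) mod l) ` {..<l} \<subseteq> {..<l}" using assms(3) by auto
    ultimately have "bij_betw (\<lambda>i. (s + i) mod l) {..<l} {..<l}"
      by (simp add: bij_betw_def endo_inj_surj)
    from bij_betw_trans[OF this g] show ?thesis by (simp add: c_def comp_def)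
  qed
  moreover have "{c i, c (Suc i)} \<in> edges A" for i
  proof -
    have "{i mod l, Suc (i mod l) mod l} \<in> edges (cycle_graph l)"
      using assms(3) by (force simp: cycle_graph_def)
    then have "{i mod l, Suc i mod l} \<in> edges (cycle_graph l)" by (simp add: mod_Suc_eq)
    then obtain e where e: "e \<in> edges A" "f ` e = {i mod l, Suc i mod l}"
      unfolding f(2)[symmetric] by auto
    have "e \<subseteq> verts A" using assms(1) e(1) by (auto simp: simple_graph_def)
    then have "g ` (f ` e) = e"
      using f(1) by (auto simp: g_def bij_betw_def image_image inv_into_f_f subset_iff)
    then show ?thesis using e by (simp add: c_def)
  qed
  moreover have "c (i + l) = c i" for i by (simp add: c_def)
  ultimately show thesis using that by blast
qed

lemma edge_between_parts:
  assumes F: "simple_graph F" "connected_graph F" and AB: "A \<union> B = verts F" "A \<inter> B = {}" "A \<noteq> {}" "B \<noteq> {}"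
  obtains a b where "a \<in> A" "b \<in> B" "{a, b} \<in> edges F"
proof -
  obtain u v where uv: "u \<in> A" "v \<in> B" using AB by auto
  have "(u, v) \<in> {(x, y). {x, y} \<in> edges F}\<^sup>*"
    using F(2) uv AB by (auto simp: connected_graph_def)
  then have "v \<in> A \<or> (\<exists>a\<in>A. \<exists>b\<in>B. {a, b} \<in> edges F)"
  proof induction
    case (step y z)
    have "z \<in> A \<union> B" using step(2) F(1) AB by (auto simp: simple_graph_def)
    then show ?case using step by auto
  qed (use uv in auto)
  then show thesis using that uv(2) AB(2) by blast
qed

text \<open>Run through the first cycle so that the joining edge \<open>a b\<close> leaves from its last vertex \<open>a\<close>, and then
  through the second cycle from \<open>b\<close>.\<close>

lemma hamiltonian_path:
  assumes F: "simple_graph F" "connected_graph F" "spanned_by_two_equal_cycles F"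
  obtains w where "bij_betw w {..<card (verts F)} (verts F)"
    "\<And>i. Suc i < card (verts F) \<Longrightarrow> {w i, w (Suc i)} \<in> edges F" "card (verts F) \<ge> 2"
proof -
  obtain l A B where l: "l \<ge> 2" and sub: "subgraph A F" "subgraph B F"
    and iso: "graph_iso A (cycle_graph l)" "graph_iso B (cycle_graph l)"
    and disj: "verts A \<inter> verts B = {}" and un: "verts A \<union> verts B = verts F"
    using F(3) by (auto simp: spanned_by_two_equal_cycles_def)
  have simple: "simple_graph A" "simple_graph B" using sub by (auto simp: subgraph_def)
  have l0: "l > 0" using l by simp
  obtain c where c: "\<And>i. {c i, c (Suc i)} \<in> edges A" "\<And>s. bij_betw (\<lambda>i. c (s + i)) {..<l} (verts A)"
      "\<And>i. c (i + l) = c i"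
    using cycle_enumeration[OF simple(1) iso(1) l0] by metis
  obtain d where d: "\<And>i. {d i, d (Suc i)} \<in> edges B" "\<And>s. bij_betw (\<lambda>i. d (s + i)) {..<l} (verts B)"
    using cycle_enumeration[OF simple(2) iso(2) l0] by metis
  have ne: "verts A \<noteq> {}" "verts B \<noteq> {}"
    using c(2)[of 0] d(2)[of 0] l by (auto simp: bij_betw_def lessThan_empty_iff)
  obtain a b where ab: "a \<in> verts A" "b \<in> verts B" "{a, b} \<in> edges F"
    using edge_between_parts[OF F(1,2) un disj ne] by blast
  obtain p where p: "a = c p" using ab(1) c(2)[of 0] by (auto simp: bij_betw_def)
  obtain q where q: "b = d q" using ab(2) d(2)[of 0] by (auto simp: bij_betw_def)
  have card: "card (verts F) = 2 * l"
  proof -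
    have "card (verts A) = l" "card (verts B) = l"
      using bij_betw_same_card[OF c(2)[of 0]] bij_betw_same_card[OF d(2)[of 0]] by auto
    moreover have "finite (verts A)" "finite (verts B)"
      using simple by (auto simp: simple_graph_def)
    ultimately show ?thesis using disj un card_Un_disjoint[of "verts A" "verts B"] by simp
  qed
  define w where "w i = (if i < l then c (Suc p + i) else d (q + (i - l)))" for i
  have "bij_betw w {..<l} (verts A)"
    using c(2)[of "Suc p"] by (rule bij_betw_cong[THEN iffD1, rotated]) (simp add: w_def)
  moreover have "bij_betw w {l..<2 * l} (verts B)"
  proof -
    have "bij_betw (\<lambda>i. i - l) {l..<2 * l} {..<l}"
      by (rule bij_betwI[where g = "\<lambda>i. i + l"]) auto
    from bij_betw_trans[OF this d(2)[of q]] show ?thesis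
      by (rule bij_betw_cong[THEN iffD1, rotated]) (simp add: w_def)
  qed
  ultimately have "bij_betw w ({..<l} \<union> {l..<2 * l}) (verts A \<union> verts B)"
    using disj by (rule bij_betw_combine)
  moreover have "{..<l} \<union> {l..<2 * l} = {..<2 * l}" by auto
  ultimately have "bij_betw w {..<card (verts F)} (verts F)" by (simp add: un card)
  moreover have "{w i, w (Suc i)} \<in> edges F" if "Suc i < card (verts F)" for i
  proof -
    consider "Suc i < l" | "Suc i = l" | "l \<le> i" by linarith
    then show ?thesis
    proof cases
      case 1
      then show ?thesis using c(1)[of "Suc p + i"] sub(1) by (auto simp: w_def subgraph_def)
    next
      case 2
      then have "w i = c (p + l)" "w (Suc i) = d q" by (auto simp: w_def)
      then show ?thesis using ab(3) p q c(3) by simp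
    next
      case 3
      then show ?thesis
        using d(1)[of "q + (i - l)"] sub(2) by (auto simp: w_def subgraph_def Suc_diff_le)
    qed
  qed
  moreover have "card (verts F) \<ge> 2" using card l by simp
  ultimately show thesis using that by blast
qed

section \<open>Factors and labelled placements\<close>

text \<open>The disjoint union of \<open>t\<close> copies of \<open>F\<close>. A factor is the image of its edges under a bijection onto the
  vertex set of \<open>G\<close>.\<close>

definition copies :: "nat \<Rightarrow> 'a graph \<Rightarrow> (nat \<times> 'a) graph" where
  "copies t F = ({..<t} \<times> verts F, {Pair j ` e |j e. j < t \<and> e \<in> edges F})"

definition placements :: "'a graph \<Rightarrow> 'b set \<Rightarrow> ('a \<Rightarrow> 'b) set" where
  "placements T V = {f. bij_betw f (verts T) V \<and> (\<forall>p. p \<notin> verts T \<longrightarrow> f p = undefined)}"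

lemma finite_placements:
  assumes "finite (verts T)" "finite V"
  shows "finite (placements T V)"
proof (rule finite_subset)
  show "placements T V \<subseteq> (verts T \<rightarrow>\<^sub>E V)"
    by (auto simp: placements_def bij_betw_def PiE_def extensional_def)
qed (simp add: assms finite_PiE)

text \<open>The automorphism group acts simply transitively on the placements with a given image of the edge set.\<close>

lemma card_placements_same_image:
  assumes T: "\<And>e. e \<in> edges T \<Longrightarrow> e \<subseteq> verts T" and f0: "f0 \<in> placements T V"
  shows "card {f \<in> placements T V. image f ` edges T = image f0 ` edges T} = card (Aut T)"
proof (rule bij_betw_same_card[symmetric])
  have inj: "inj_on f0 (verts T)" and img: "f0 ` verts T = V"
    using f0 by (auto simp: placements_def bij_betw_def)
  have inj_edges: "inj_on (image f0) (Pow (verts T))" using inj by (rule inj_on_image_Pow)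
  let ?S = "{f \<in> placements T V. image f ` edges T = image f0 ` edges T}"
  show "bij_betw (\<lambda>\<sigma>. f0 \<circ> \<sigma>) (Aut T) ?S"
  proof (rule bij_betw_imageI)
    show "inj_on (\<lambda>\<sigma>. f0 \<circ> \<sigma>) (Aut T)"
    proof (rule inj_onI)
      fix \<sigma> \<tau> assume *: "\<sigma> \<in> Aut T" "\<tau> \<in> Aut T" "f0 \<circ> \<sigma> = f0 \<circ> \<tau>"
      show "\<sigma> = \<tau>"
      proof
        fix x
        have "f0 (\<sigma> x) = f0 (\<tau> x)" using *(3) by (simp add: fun_eq_iff)
        moreover have "\<sigma> x \<in> verts T \<longleftrightarrow> x \<in> verts T" "\<tau> x \<in> verts T \<longleftrightarrow> x \<in> verts T"
          using * by (auto simp: Aut_def permutes_in_image)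
        moreover have "x \<notin> verts T \<Longrightarrow> \<sigma> x = x" "x \<notin> verts T \<Longrightarrow> \<tau> x = x"
          using * by (auto simp: Aut_def permutes_not_in)
        ultimately show "\<sigma> x = \<tau> x" using inj by (metis inj_on_eq_iff)
      qed
    qed
    show "(\<lambda>\<sigma>. f0 \<circ> \<sigma>) ` Aut T = ?S"
    proof (intro equalityI subsetI)
      fix f assume "f \<in> (\<lambda>\<sigma>. f0 \<circ> \<sigma>) ` Aut T"
      then obtain \<sigma> where s: "\<sigma> \<in> Aut T" and f: "f = f0 \<circ> \<sigma>" by auto
      have perm: "\<sigma> permutes verts T" using s by (simp add: Aut_def)
      have "bij_betw f (verts T) V"
        unfolding f using permutes_imp_bij[OF perm] f0 by (auto simp: placements_def intro: bij_betw_trans)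
      moreover have "f p = undefined" if "p \<notin> verts T" for p
        using that permutes_not_in[OF perm that] f0 by (auto simp: f placements_def)
      moreover have "image f ` edges T = image f0 ` (image \<sigma> ` edges T)"
        by (simp add: f image_comp[symmetric] image_image)
      then have "image f ` edges T = image f0 ` edges T" using s by (simp add: Aut_def)
      ultimately show "f \<in> ?S" by (auto simp: placements_def)
    next
      fix f assume f: "f \<in> ?S"
      define \<sigma> where "\<sigma> p = (if p \<in> verts T then inv_into (verts T) f0 (f p) else p)" for p
      have bf: "bij_betw f (verts T) V" and fu: "\<And>p. p \<notin> verts T \<Longrightarrow> f p = undefined"
        using f by (auto simp: placements_def)
      have "bij_betw (inv_into (verts T) f0 \<circ> f) (verts T) (verts T)"
        using bf bij_betw_inv_into[of f0 "verts T" V] f0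
        by (auto simp: placements_def intro: bij_betw_trans)
      then have "bij_betw \<sigma> (verts T) (verts T)"
        by (rule bij_betw_cong[THEN iffD1, rotated]) (simp add: \<sigma>_def)
      then have perm: "\<sigma> permutes verts T"
        by (rule bij_imp_permutes) (simp add: \<sigma>_def)
      have f_eq: "f0 \<circ> \<sigma> = f"
      proof
        fix p show "(f0 \<circ> \<sigma>) p = f p"
          using fu[of p] f0 bij_betwE[OF bf] img
          by (auto simp: \<sigma>_def f_inv_into_f placements_def)
      qed
      have "image f0 ` (image \<sigma> ` edges T) = image f ` edges T"
        by (simp add: f_eq[symmetric] image_comp[symmetric] image_image)
      also have "\<dots> = image f0 ` edges T" using f by simp
      finally have "image \<sigma> ` edges T = edges T"
        using T permutes_in_image[OF perm]
        by (subst (asm) inj_on_image_eq_iff[OF inj_edges]) auto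
      then have "\<sigma> \<in> Aut T" using perm by (simp add: Aut_def)
      then show "f \<in> (\<lambda>\<sigma>. f0 \<circ> \<sigma>) ` Aut T" using f_eq by blast
    qed
  qed
qed

lemma card_placements:
  fixes T :: "'a graph"
  assumes "finite V" "card (verts T) = card V" "finite (verts T)"
  shows "card (placements T V) = fact (card V)"
proof -
  let ?T = "(verts T, {}) :: 'a graph"
  obtain g where g: "bij_betw g (verts T) V"
    using assms finite_same_card_bij by blast
  define f0 where "f0 p = (if p \<in> verts T then g p else undefined)" for p
  have "bij_betw f0 (verts T) V"
    using g by (rule bij_betw_cong[THEN iffD1, rotated]) (simp add: f0_def)
  then have f0: "f0 \<in> placements ?T V" by (simp add: placements_def f0_def)
  have "card (placements T V) = card {f \<in> placements ?T V. image f ` edges ?T = image f0 ` edges ?T}"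
    by (simp add: placements_def)
  also have "\<dots> = card (Aut ?T)" by (rule card_placements_same_image[OF _ f0]) simp
  also have "\<dots> = fact (card V)" using assms card_permutations[of "verts T"] by (simp add: Aut_def)
  finally show ?thesis .
qed

lemma simple_graph_edges: "simple_graph F \<Longrightarrow> e \<in> edges F \<Longrightarrow> e \<subseteq> verts F"
  by (auto simp: simple_graph_def)

lemma edges_copies_subset:
  assumes "simple_graph F" "e \<in> edges (copies t F)"
  shows "e \<subseteq> verts (copies t F)"
  using assms by (auto simp: copies_def simple_graph_def)

text \<open>The components have \<open>card (verts F)\<close> vertices each, so there are exactly \<open>t\<close> of them; numbering them
  and fixing an isomorphism for each gives the placement.\<close>

lemma factor_imp_placement:
  fixes F :: "'a graph" and G H :: "'b graph"
  assumes F: "simple_graph F" "verts F \<noteq> {}" and G: "simple_graph G" "card (verts G) = card (verts F) * t"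
    and H: "H \<in> factors F G"
  shows "\<exists>f\<in>placements (copies t F) (verts G). image f ` edges (copies t F) = edges H"
proof -
  have vG: "verts H = verts G" using H by (simp add: factors_def)
  have "disjoint_union_of_copies F H" using H by (simp add: factors_def)
  then obtain K where *: "\<forall>A\<in>K. simple_graph A \<and> graph_iso A F"
      "\<forall>A\<in>K. \<forall>B\<in>K. A \<noteq> B \<longrightarrow> verts A \<inter> verts B = {}"
    and vH: "verts H = (\<Union>A\<in>K. verts A)" and eH: "edges H = (\<Union>A\<in>K. edges A)"
    unfolding disjoint_union_of_copies_def by (elim exE conjE)
  have K: "simple_graph A \<and> graph_iso A F" if "A \<in> K" for A using *(1) that by (rule bspec)
  have disj: "verts A \<inter> verts B = {}" if "A \<in> K" "B \<in> K" "A \<noteq> B" for A B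
    using *(2) that by simp
  have fin: "finite (verts F)" "finite (verts G)" using F G by (auto simp: simple_graph_def)
  have "\<exists>g. bij_betw g (verts F) (verts A) \<and> image g ` edges F = edges A" if A: "A \<in> K" for A
  proof -
    obtain f where f: "bij_betw f (verts A) (verts F)" "image f ` edges A = edges F"
      using K[OF A] by (auto simp: graph_iso_def)
    have "image (inv_into (verts A) f) ` edges F = edges A"
    proof -
      have "inv_into (verts A) f ` f ` e = e" if "e \<in> edges A" for e
        using simple_graph_edges[of A e] K[OF A] that f(1) by (simp add: bij_betw_def inv_into_image_cancel)
      then show ?thesis by (simp add: f(2)[symmetric] image_image)
    qed
    then show ?thesis using bij_betw_inv_into[OF f(1)] by blast
  qed
  then obtain g where g: "\<And>A. A \<in> K \<Longrightarrow> bij_betw (g A) (verts F) (verts A)"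
    "\<And>A. A \<in> K \<Longrightarrow> image (g A) ` edges F = edges A"
    by metis
  have card_A: "card (verts A) = card (verts F)" and ne_A: "verts A \<noteq> {}" if "A \<in> K" for A
    using bij_betw_same_card[OF g(1)[OF that]] g(1)[OF that] F by (auto simp: bij_betw_def)
  have "inj_on verts K"
    using disj ne_A by (intro inj_onI) (metis Int_absorb)
  moreover have "verts ` K \<subseteq> Pow (verts G)" using vH vG by auto
  ultimately have finK: "finite K"
    using fin by (meson finite_Pow_iff finite_imageD finite_subset)
  have "card (verts G) = (\<Sum>A\<in>K. card (verts A))"
    unfolding vG[symmetric] vH
    using finK disj K by (intro card_UN_disjoint) (auto simp: simple_graph_def)
  then have "card K = t" using card_A G(2) F fin by simp
  then obtain h where h: "bij_betw h {..<t} K"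
    using finK ex_bij_betw_nat_finite[of K] by (auto simp: atLeast0LessThan)
  have hK: "h j \<in> K" if "j < t" for j using h that by (auto simp: bij_betw_def)
  define f where "f p = (if p \<in> verts (copies t F) then g (h (fst p)) (snd p) else undefined)" for p
  have "inj_on f ({..<t} \<times> verts F)"
  proof (rule inj_onI)
    fix p p' assume p: "p \<in> {..<t} \<times> verts F" "p' \<in> {..<t} \<times> verts F" "f p = f p'"
    obtain j x j' x' where pp: "p = (j, x)" "p' = (j', x')" by (cases p, cases p')
    have *: "j \<in> {..<t}" "j' \<in> {..<t}" "x \<in> verts F" "x' \<in> verts F" "f (j, x) = f (j', x')"
      using p pp by simp_all
    then have eq: "g (h j) x = g (h j') x'" by (simp add: f_def copies_def)
    have "g (h j) x \<in> verts (h j)" "g (h j') x' \<in> verts (h j')"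
      using * g(1)[OF hK] by (auto simp: bij_betw_def)
    then have "h j = h j'" using eq disj[of "h j" "h j'"] hK * by auto
    then have "j = j'" using h * by (auto simp: bij_betw_def inj_on_def)
    moreover have "x = x'" using eq g(1)[OF hK[of j]] * \<open>j = j'\<close> by (auto simp: bij_betw_def inj_on_def)
    ultimately show "p = p'" using pp by simp
  qed
  moreover have "f ` ({..<t} \<times> verts F) = verts G"
  proof -
    have "f ` ({..<t} \<times> verts F) = (\<Union>j<t. g (h j) ` verts F)"
      by (force simp: f_def copies_def)
    also have "\<dots> = (\<Union>j<t. verts (h j))" using g(1)[OF hK] by (auto simp: bij_betw_def)
    also have "\<dots> = (\<Union>A\<in>h ` {..<t}. verts A)" by simp
    also have "\<dots> = verts G" using h vH vG by (simp add: bij_betw_def)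
    finally show ?thesis .
  qed
  ultimately have "f \<in> placements (copies t F) (verts G)"
    unfolding placements_def by (simp add: copies_def bij_betw_def) (simp add: f_def copies_def)
  moreover have "image f ` edges (copies t F) = edges H"
  proof -
    have f_edge: "f ` Pair j ` e = g (h j) ` e" if "j < t" "e \<in> edges F" for j e
      unfolding image_image using that simple_graph_edges[OF F(1) that(2)]
      by (intro image_cong refl) (auto simp: f_def copies_def)
    have "image f ` edges (copies t F) = (\<Union>j<t. (\<lambda>e. f ` Pair j ` e) ` edges F)"
      by (auto simp: copies_def)
    also have "\<dots> = (\<Union>j<t. image (g (h j)) ` edges F)"
      by (intro SUP_cong image_cong refl f_edge) simp_all
    also have "\<dots> = (\<Union>A\<in>h ` {..<t}. edges A)" using g(2)[OF hK] by simp
    also have "\<dots> = edges H" using h eH by (simp add: bij_betw_def)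
    finally show ?thesis .
  qed
  ultimately show ?thesis unfolding Bex_def by (intro exI conjI)
qed

lemma placement_imp_factor:
  fixes F :: "'a graph" and G H :: "'b graph"
  assumes F: "simple_graph F" and G: "simple_graph G"
    and v: "verts H = verts G" and e: "edges H \<subseteq> edges G"
    and ex: "\<exists>f\<in>placements (copies t F) (verts G). image f ` edges (copies t F) = edges H"
  shows "H \<in> factors F G"
proof -
  from ex obtain f where f: "bij_betw f ({..<t} \<times> verts F) (verts G)" "image f ` edges (copies t F) = edges H"
    by (auto simp: placements_def copies_def)
  have inj: "inj_on f ({..<t} \<times> verts F)" and img: "f ` ({..<t} \<times> verts F) = verts G"
    using f(1) by (auto simp: bij_betw_def)
  define g where "g j x = f (j, x)" for j x
  have inj_g: "inj_on (g j) (verts F)" if "j < t" for j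
    using inj that by (auto simp: inj_on_def g_def)
  define A where "A j = (g j ` verts F, image (g j) ` edges F)" for j
  have "simple_graph (A j) \<and> graph_iso (A j) F" if j: "j < t" for j
  proof
    show "simple_graph (A j)"
      unfolding simple_graph_def
    proof (intro conjI ballI)
      show "finite (verts (A j))" using F by (simp add: simple_graph_def A_def)
      fix e' assume "e' \<in> edges (A j)"
      then obtain e where e: "e \<in> edges F" "e' = g j ` e" by (auto simp: A_def)
      have "e \<subseteq> verts F" "card e = 2" using F e(1) by (simp_all add: simple_graph_def)
      then show "e' \<subseteq> verts (A j)" "card e' = 2"
        using inj_on_subset[OF inj_g[OF j]] by (auto simp: e(2) A_def card_image)
    qed
    let ?i = "inv_into (verts F) (g j)"
    have "bij_betw ?i (verts (A j)) (verts F)"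
      by (rule bij_betw_inv_into) (simp add: A_def inj_g[OF j] bij_betw_def)
    moreover have "?i ` g j ` e = e" if "e \<in> edges F" for e
      using simple_graph_edges[OF F that] inj_g[OF j] by (simp add: inv_into_image_cancel)
    then have "image ?i ` edges (A j) = edges F" by (simp add: A_def image_image)
    ultimately show "graph_iso (A j) F" unfolding graph_iso_def by blast
  qed
  moreover have "verts (A i) \<inter> verts (A j) = {}" if "i < t" "j < t" "i \<noteq> j" for i j
    using inj that by (auto simp: A_def g_def inj_on_def)
  moreover have "verts H = (\<Union>B\<in>A ` {..<t}. verts B)"
  proof -
    have "f ` ({..<t} \<times> verts F) = (\<Union>j<t. g j ` verts F)" by (auto simp: g_def)
    then show ?thesis unfolding v img[symmetric] by (simp add: A_def)
  qed
  moreover have "edges H = (\<Union>B\<in>A ` {..<t}. edges B)"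
  proof -
    have "image f ` edges (copies t F) = (\<Union>j<t. (\<lambda>e. f ` Pair j ` e) ` edges F)"
      by (auto simp: copies_def)
    also have "\<dots> = (\<Union>j<t. image (g j) ` edges F)" by (simp add: image_image g_def)
    finally show ?thesis unfolding f(2)[symmetric] by (simp add: A_def)
  qed
  ultimately have "disjoint_union_of_copies F H"
    unfolding disjoint_union_of_copies_def
    by (intro exI[of _ "A ` {..<t}"] conjI ballI impI) (simp, blast+)
  moreover have "simple_graph H" using G v e by (auto simp: simple_graph_def)
  ultimately show "H \<in> factors F G" using v e by (simp add: factors_def subgraph_def)
qed

text \<open>Double counting: a placement of \<open>t\<close> copies of \<open>F\<close> into \<open>G\<close> has a factor as its image, and the placements
  with the same image form one orbit of the automorphism group.\<close>

lemma card_placements_into: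
  fixes F :: "'a graph" and G :: "nat graph"
  assumes F: "simple_graph F" "verts F \<noteq> {}" and G: "simple_graph G" "card (verts G) = card (verts F) * t"
  shows "card {f \<in> placements (copies t F) (verts G). image f ` edges (copies t F) \<subseteq> edges G} =
    card (factors F G) * card (Aut (copies t F))"
proof -
  let ?T = "copies t F"
  let ?P = "\<lambda>H. {f \<in> placements ?T (verts G). image f ` edges ?T = edges H}"
  have fin: "finite (verts ?T)" "finite (verts G)" using F(1) G(1) by (simp_all add: simple_graph_def copies_def)
  have finP: "finite (?P H)" for H using finite_placements[OF fin] by simp
  have finF: "finite (factors F G)"
    using G(1) by (intro card_factors_le(1)[of G "card (verts G)" "card (edges G)"]) (simp add: graphs_with_def)
  have "{f \<in> placements ?T (verts G). image f ` edges ?T \<subseteq> edges G} = (\<Union>H\<in>factors F G. ?P H)"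
  proof (intro equalityI subsetI)
    fix f assume f: "f \<in> {f \<in> placements ?T (verts G). image f ` edges ?T \<subseteq> edges G}"
    then have "(verts G, image f ` edges ?T) \<in> factors F G"
      by (intro placement_imp_factor[OF F(1) G(1)]) auto
    then show "f \<in> (\<Union>H\<in>factors F G. ?P H)" by (rule UN_I) (use f in simp)
  next
    fix f assume "f \<in> (\<Union>H\<in>factors F G. ?P H)"
    then obtain H where "H \<in> factors F G" "f \<in> ?P H" by blast
    then show "f \<in> {f \<in> placements ?T (verts G). image f ` edges ?T \<subseteq> edges G}"
      by (auto simp: factors_def subgraph_def)
  qed
  also have "card \<dots> = (\<Sum>H\<in>factors F G. card (?P H))"
  proof (intro card_UN_disjoint finF ballI impI finP)
    fix H H' assume *: "H \<in> factors F G" "H' \<in> factors F G" "H \<noteq> H'"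
    then have "edges H \<noteq> edges H'" by (auto simp: factors_def prod_eq_iff)
    then show "?P H \<inter> ?P H' = {}" by auto
  qed
  also have "\<dots> = (\<Sum>H\<in>factors F G. card (Aut ?T))"
  proof (intro sum.cong refl)
    fix H assume "H \<in> factors F G"
    then obtain f0 where f0: "f0 \<in> placements ?T (verts G)" "image f0 ` edges ?T = edges H"
      using factor_imp_placement[OF assms] by blast
    then show "card (?P H) = card (Aut ?T)"
      using card_placements_same_image[OF edges_copies_subset[OF F(1)] f0(1)] by simp
  qed
  finally show ?thesis by simp
qed

section \<open>Automorphisms of a disjoint union\<close>

text \<open>The action of the wreath product: \<open>\<pi>\<close> permutes the copies, and \<open>\<alpha> j\<close> acts inside copy \<open>j\<close> before it is
  moved.\<close>

definition block_map :: "nat \<Rightarrow> 'a set \<Rightarrow> (nat \<Rightarrow> nat) \<times> (nat \<Rightarrow> 'a \<Rightarrow> 'a) \<Rightarrow> nat \<times> 'a \<Rightarrow> nat \<times> 'a" where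
  "block_map t W = (\<lambda>(\<pi>, \<alpha>) (j, x). if j < t \<and> x \<in> W then (\<pi> j, \<alpha> j x) else (j, x))"

lemma block_map_in_Aut:
  assumes F: "simple_graph F" and \<pi>: "\<pi> permutes {..<t}" and \<alpha>: "\<And>j. j < t \<Longrightarrow> \<alpha> j \<in> Aut F"
  shows "block_map t (verts F) (\<pi>, \<alpha>) \<in> Aut (copies t F)"
proof -
  let ?D = "{..<t} \<times> verts F" and ?s = "block_map t (verts F) (\<pi>, \<alpha>)"
  have \<alpha>_perm: "\<alpha> j permutes verts F" and \<alpha>_edges: "image (\<alpha> j) ` edges F = edges F" if "j < t" for j
    using \<alpha>[OF that] by (auto simp: Aut_def)
  have \<pi>_less: "\<pi> j < t \<longleftrightarrow> j < t" for j using permutes_in_image[OF \<pi>, of j] by simp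
  have fin: "finite ?D" using F by (simp add: simple_graph_def)
  have into: "?s ` ?D \<subseteq> ?D"
    by (auto simp: block_map_def \<pi>_less permutes_in_image[OF \<alpha>_perm])
  have inj: "inj_on ?s ?D"
  proof (rule inj_onI)
    fix p q assume pq: "p \<in> ?D" "q \<in> ?D" "?s p = ?s q"
    obtain j x j' x' where eq: "p = (j, x)" "q = (j', x')" by (cases p, cases q)
    have "\<pi> j = \<pi> j'" "\<alpha> j x = \<alpha> j' x'" using pq by (auto simp: eq block_map_def)
    then show "p = q"
      using pq permutes_inj[OF \<pi>] permutes_inj[OF \<alpha>_perm[of j]] by (auto simp: eq dest: injD)
  qed
  have "?s ` ?D = ?D" using fin into inj by (rule endo_inj_surj)
  then have perm: "?s permutes ?D"
    using inj by (intro bij_imp_permutes) (auto simp: bij_betw_def block_map_def)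
  have "image ?s ` edges (copies t F) \<subseteq> edges (copies t F)"
  proof
    fix e' assume "e' \<in> image ?s ` edges (copies t F)"
    then obtain j e where e: "j < t" "e \<in> edges F" "e' = ?s ` Pair j ` e" by (auto simp: copies_def)
    have "e' = Pair (\<pi> j) ` \<alpha> j ` e"
      unfolding e(3) image_image using simple_graph_edges[OF F e(2)] e(1)
      by (intro image_cong refl) (auto simp: block_map_def)
    moreover have "\<alpha> j ` e \<in> edges F" using \<alpha>_edges[OF e(1)] e(2) by blast
    ultimately show "e' \<in> edges (copies t F)" using e(1) \<pi>_less[of j] by (auto simp: copies_def)
  qed
  moreover have sub: "edges (copies t F) \<subseteq> Pow ?D"
    using simple_graph_edges[OF F] by (auto simp: copies_def)
  then have "finite (edges (copies t F))" using fin by (meson finite_Pow_iff finite_subset)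
  moreover have "inj_on (image ?s) (edges (copies t F))"
    using inj_on_image_Pow[OF inj] sub by (rule inj_on_subset)
  ultimately have "image ?s ` edges (copies t F) = edges (copies t F)" by (intro endo_inj_surj)
  then show ?thesis using perm by (simp add: Aut_def copies_def)
qed

text \<open>An automorphism sends edges to edges, every edge lies in one copy, and \<open>F\<close> is connected. So an
  automorphism cannot tear a copy apart.\<close>

lemma Aut_copies_keeps_blocks:
  assumes F: "simple_graph F" "connected_graph F" and s: "s \<in> Aut (copies t F)"
    and j: "j < t" and xy: "x \<in> verts F" "y \<in> verts F"
  shows "fst (s (j, x)) = fst (s (j, y))"
proof -
  have "(x, y) \<in> {(x, y). {x, y} \<in> edges F}\<^sup>*" using F xy by (simp add: connected_graph_def)
  then show ?thesis
  proof induction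
    case (step y z)
    then have "{y, z} \<in> edges F" by simp
    then have "Pair j ` {y, z} \<in> edges (copies t F)" using j unfolding copies_def snd_conv by blast
    then have "s ` Pair j ` {y, z} \<in> edges (copies t F)" using s unfolding Aut_def by blast
    then obtain j' e where e: "s ` Pair j ` {y, z} = Pair j' ` e" by (auto simp: copies_def)
    have "s (j, y) \<in> Pair j' ` e" "s (j, z) \<in> Pair j' ` e" unfolding e[symmetric] by auto
    then show ?case using step.IH by auto
  qed simp
qed

lemma Aut_copies_is_block_map:
  assumes F: "simple_graph F" "connected_graph F" and s: "s \<in> Aut (copies t F)"
  shows "\<exists>\<pi> \<alpha>. \<pi> permutes {..<t} \<and> \<alpha> \<in> {..<t} \<rightarrow>\<^sub>E Aut F \<and> s = block_map t (verts F) (\<pi>, \<alpha>)"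
proof -
  let ?W = "verts F" and ?D = "{..<t} \<times> verts F"
  obtain x0 where x0: "x0 \<in> ?W" using F(2) by (auto simp: connected_graph_def)
  have fin: "finite ?W" using F(1) by (simp add: simple_graph_def)
  have perm: "s permutes ?D" and s_edges: "image s ` edges (copies t F) = edges (copies t F)"
    using s by (auto simp: Aut_def copies_def)
  have s_in: "s p \<in> ?D \<longleftrightarrow> p \<in> ?D" for p by (rule permutes_in_image[OF perm])
  define \<pi> where "\<pi> j = (if j < t then fst (s (j, x0)) else j)" for j
  define \<alpha> where "\<alpha> = (\<lambda>j\<in>{..<t}. \<lambda>x. if x \<in> ?W then snd (s (j, x)) else x)"
  have s_eq: "s (j, x) = (\<pi> j, \<alpha> j x)" if "j < t" "x \<in> ?W" for j x
    using that Aut_copies_keeps_blocks[OF F s that(1) x0 that(2)] by (simp add: \<pi>_def \<alpha>_def prod_eq_iff)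
  have \<pi>_less: "\<pi> j < t" and \<alpha>_in: "x \<in> ?W \<Longrightarrow> \<alpha> j x \<in> ?W" if "j < t" for j x
    using s_in[of "(j, x0)"] s_in[of "(j, x)"] s_eq[of j x0] s_eq[of j x] that x0 by auto
  have "{..<t} \<subseteq> \<pi> ` {..<t}"
  proof
    fix c assume "c \<in> {..<t}"
    then have "(c, x0) \<in> s ` ?D" using permutes_image[OF perm] x0 by simp
    then obtain j x where "j < t" "x \<in> ?W" "s (j, x) = (c, x0)" by auto
    then show "c \<in> \<pi> ` {..<t}" using s_eq[of j x] by auto
  qed
  moreover have "\<pi> ` {..<t} \<subseteq> {..<t}" using \<pi>_less by auto
  ultimately have \<pi>_img: "\<pi> ` {..<t} = {..<t}" by simp
  then have "inj_on \<pi> {..<t}" by (intro eq_card_imp_inj_on) auto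
  then have \<pi>_perm: "\<pi> permutes {..<t}"
    using \<pi>_img by (intro bij_imp_permutes) (auto simp: bij_betw_def \<pi>_def)
  have "\<alpha> j \<in> Aut F" if j: "j < t" for j
  proof -
    have inj: "inj_on (\<alpha> j) ?W"
    proof (rule inj_onI)
      fix x y assume "x \<in> ?W" "y \<in> ?W" "\<alpha> j x = \<alpha> j y"
      then have "s (j, x) = s (j, y)" using j by (simp add: s_eq)
      then show "x = y" using permutes_inj[OF perm] by (auto dest: injD)
    qed
    moreover have "\<alpha> j ` ?W \<subseteq> ?W" using \<alpha>_in[OF j] by auto
    ultimately have "\<alpha> j ` ?W = ?W" by (intro endo_inj_surj fin)
    then have perm_j: "\<alpha> j permutes ?W"
      using inj j by (intro bij_imp_permutes) (auto simp: bij_betw_def \<alpha>_def)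
    have "image (\<alpha> j) ` edges F \<subseteq> edges F"
    proof
      fix e' assume "e' \<in> image (\<alpha> j) ` edges F"
      then obtain e where e: "e \<in> edges F" "e' = \<alpha> j ` e" by auto
      have "Pair j ` e \<in> edges (copies t F)" using e(1) j by (auto simp: copies_def)
      then have "s ` Pair j ` e \<in> edges (copies t F)" using s_edges by blast
      moreover have "s ` Pair j ` e = Pair (\<pi> j) ` e'"
        unfolding e(2) image_image using simple_graph_edges[OF F(1) e(1)] j
        by (intro image_cong refl) (auto simp: s_eq)
      ultimately obtain j' e'' where e'': "e'' \<in> edges F" "Pair (\<pi> j) ` e' = Pair j' ` e''"
        by (auto simp: copies_def)
      have "e' = snd ` Pair (\<pi> j) ` e'" by (simp add: image_image)
      also have "\<dots> = e''" by (simp add: e''(2) image_image)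
      finally show "e' \<in> edges F" using e''(1) by simp
    qed
    moreover have sub: "edges F \<subseteq> Pow ?W" using simple_graph_edges[OF F(1)] by auto
    then have "finite (edges F)" using fin by (meson finite_Pow_iff finite_subset)
    moreover have "inj_on (image (\<alpha> j)) (edges F)"
      using inj_on_image_Pow[OF inj] sub by (rule inj_on_subset)
    ultimately have "image (\<alpha> j) ` edges F = edges F" by (intro endo_inj_surj)
    then show ?thesis using perm_j by (simp add: Aut_def)
  qed
  then have "\<alpha> \<in> {..<t} \<rightarrow>\<^sub>E Aut F" by (auto simp: PiE_def \<alpha>_def)
  moreover have "s p = block_map t ?W (\<pi>, \<alpha>) p" for p
  proof (cases p)
    case (Pair j x)
    then show ?thesis
      using s_eq[of j x] permutes_not_in[OF perm, of p] by (auto simp: block_map_def)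
  qed
  ultimately show ?thesis using \<pi>_perm by blast
qed

lemma card_Aut_copies:
  assumes F: "simple_graph F" "connected_graph F"
  shows "card (Aut (copies t F)) = fact t * card (Aut F) ^ t"
proof -
  let ?P = "{\<pi>. \<pi> permutes {..<t}} \<times> ({..<t} \<rightarrow>\<^sub>E Aut F)"
  obtain x0 where x0: "x0 \<in> verts F" using F(2) by (auto simp: connected_graph_def)
  have "inj_on (block_map t (verts F)) ?P"
  proof (rule inj_onI)
    fix a b assume ab: "a \<in> ?P" "b \<in> ?P" "block_map t (verts F) a = block_map t (verts F) b"
    obtain \<pi> \<alpha> \<pi>' \<alpha>' where eq: "a = (\<pi>, \<alpha>)" "b = (\<pi>', \<alpha>')" by (cases a, cases b)
    have same: "\<pi> j = \<pi>' j \<and> \<alpha> j x = \<alpha>' j x" if "j < t" "x \<in> verts F" for j x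
      using fun_cong[OF ab(3), of "(j, x)"] that by (simp add: eq block_map_def)
    have "\<pi> j = \<pi>' j" for j
      using same[OF _ x0, of j] ab(1,2) permutes_not_in[of \<pi> "{..<t}" j] permutes_not_in[of \<pi>' "{..<t}" j]
      by (cases "j < t") (auto simp: eq)
    moreover have "\<alpha> j = \<alpha>' j" for j
    proof (cases "j < t")
      case True
      then have "\<alpha> j permutes verts F" "\<alpha>' j permutes verts F"
        using ab(1,2) by (auto simp: eq Aut_def PiE_def Pi_def)
      then have "\<alpha> j x = \<alpha>' j x" for x
        using same[OF True, of x] permutes_not_in[of "\<alpha> j" _ x] permutes_not_in[of "\<alpha>' j" _ x]
        by (cases "x \<in> verts F") auto
      then show ?thesis by auto
    next
      case False
      then show ?thesis using ab(1,2) PiE_arb[of \<alpha>] PiE_arb[of \<alpha>'] by (auto simp: eq)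
    qed
    ultimately show "a = b" by (auto simp: eq)
  qed
  moreover have "block_map t (verts F) ` ?P = Aut (copies t F)"
  proof (intro equalityI subsetI)
    fix s assume "s \<in> block_map t (verts F) ` ?P"
    then obtain \<pi> \<alpha> where "s = block_map t (verts F) (\<pi>, \<alpha>)" "\<pi> permutes {..<t}" "\<alpha> \<in> {..<t} \<rightarrow>\<^sub>E Aut F"
      by auto
    then show "s \<in> Aut (copies t F)" using block_map_in_Aut[OF F(1), of \<pi> t \<alpha>] by auto
  next
    fix s assume "s \<in> Aut (copies t F)"
    from Aut_copies_is_block_map[OF F this] show "s \<in> block_map t (verts F) ` ?P" by blast
  qed
  ultimately have "card (Aut (copies t F)) = card ?P" using card_image by fastforce
  also have "\<dots> = fact t * card (Aut F) ^ t"
    by (simp add: card_cartesian_product card_PiE card_permutations[OF refl])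
  finally show ?thesis .
qed

section \<open>Bounds for the number of factors\<close>

lemma (in path_tilings) sum_deg: "(\<Sum>v\<in>V. deg v) = 2 * card E"
proof -
  have "E \<subseteq> Pow V" using edge by auto
  then have fin: "finite E" using finite_V by (meson finite_Pow_iff finite_subset)
  have "deg v = card {e \<in> E. v \<in> e}" for v
  proof (rule bij_betw_same_card)
    show "bij_betw (\<lambda>u. {v, u}) (nbrs v) {e \<in> E. v \<in> e}"
    proof (rule bij_betw_imageI)
      show "inj_on (\<lambda>u. {v, u}) (nbrs v)" by (auto simp: inj_on_def doubleton_eq_iff)
      show "(\<lambda>u. {v, u}) ` nbrs v = {e \<in> E. v \<in> e}"
      proof (intro equalityI subsetI)
        fix e assume e: "e \<in> {e \<in> E. v \<in> e}"
        then have "card e = 2" using edge by blast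
        then obtain x y where "e = {x, y}" by (auto simp: card_2_iff)
        then have "e = {v, x} \<or> e = {v, y}" using e by auto
        then show "e \<in> (\<lambda>u. {v, u}) ` nbrs v" using e by (auto simp: nbrs_def)
      qed (auto simp: nbrs_def)
    qed
  qed
  moreover have "{v \<in> V. v \<in> e} = e" if "e \<in> E" for e using edge[OF that] by auto
  then have "(\<Sum>v\<in>V. card {e \<in> E. v \<in> e}) = 2 * card E"
    using edge fin finite_V by (intro sum_multicount) auto
  ultimately show ?thesis by simp
qed

lemma path_tilings_graph:
  assumes "simple_graph G" "k \<ge> 2"
  shows "path_tilings (verts G) (edges G) k"
  using assms by unfold_locales (auto simp: simple_graph_def)

text \<open>Composing a placement with a Hamiltonian path of \<open>F\<close> gives a path tiling of \<open>G\<close>. The path visits all vertices,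
  so different placements give different tilings.\<close>

lemma card_factors_le_card_tilings:
  fixes F :: "'a graph" and G :: "nat graph"
  assumes F: "simple_graph F" "connected_graph F" and w: "bij_betw w {..<k} (verts F)" "k \<ge> 2"
    "\<And>i. Suc i < k \<Longrightarrow> {w i, w (Suc i)} \<in> edges F"
    and G: "simple_graph G" "card (verts G) = k * t"
  shows "card (factors F G) * (fact t * card (Aut F) ^ t) \<le>
    card (path_tilings.tilings (verts G) (edges G) k t)"
proof -
  interpret path_tilings "verts G" "edges G" k t
    using path_tilings_graph[OF G(1) w(2)] .
  let ?T = "copies t F"
  let ?P = "{f \<in> placements ?T (verts G). image f ` edges ?T \<subseteq> edges G}"
  define r where "r f = (\<lambda>(j, i). if j < t \<and> i < k then f (j, w i) else undefined)" for f :: "nat \<times> 'a \<Rightarrow> nat"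
  have k: "card (verts F) = k" using bij_betw_same_card[OF w(1)] by simp
  have ne: "verts F \<noteq> {}" using k w(2) by auto
  have "card (factors F G) * (fact t * card (Aut F) ^ t) = card ?P"
    using card_placements_into[OF F(1) ne G(1)] card_Aut_copies[OF F] G(2) by (simp add: k)
  also have "\<dots> \<le> card tilings"
  proof (rule card_inj_on_le)
    show "finite tilings" by (rule finite_tilings)
    show "inj_on r ?P"
    proof (rule inj_onI)
      fix f g assume fg: "f \<in> ?P" "g \<in> ?P" "r f = r g"
      have "f (j, x) = g (j, x)" for j x
      proof (cases "(j, x) \<in> verts ?T")
        case True
        then obtain i where "i < k" "x = w i" "j < t" using w(1) by (auto simp: copies_def bij_betw_def)
        then show ?thesis using fun_cong[OF fg(3), of "(j, i)"] by (simp add: r_def)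
      next
        case False
        then have "f (j, x) = undefined" "g (j, x) = undefined"
          using fg(1,2) unfolding placements_def by blast+
        then show ?thesis by simp
      qed
      then show "f = g" by auto
    qed
    show "r ` ?P \<subseteq> tilings"
    proof
      fix g assume "g \<in> r ` ?P"
      then obtain f where f: "f \<in> ?P" and g: "g = r f" by blast
      have "bij_betw (map_prod id w) D (verts ?T)"
        unfolding copies_def fst_conv by (intro bij_betw_map_prod w(1)) simp
      moreover have "bij_betw f (verts ?T) (verts G)" using f by (simp add: placements_def)
      ultimately have "bij_betw (f \<circ> map_prod id w) D (verts G)" by (rule bij_betw_trans)
      then have "bij_betw g D (verts G)"
        by (rule bij_betw_cong[THEN iffD1, rotated]) (auto simp: g r_def)
      moreover have "g p = undefined" if "p \<notin> D" for p
        using that by (auto simp: g r_def split: prod.splits)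
      moreover have "{g (j, i), g (j, Suc i)} \<in> edges G" if "j < t" "Suc i < k" for j i
      proof -
        have "Pair j ` {w i, w (Suc i)} \<in> edges ?T"
          unfolding copies_def snd_conv using w(3)[OF that(2)] that(1) by blast
        then have "f ` Pair j ` {w i, w (Suc i)} \<in> edges G" using f by blast
        then show ?thesis using that by (simp add: g r_def)
      qed
      ultimately show "g \<in> tilings" unfolding tilings_def by blast
    qed
  qed
  finally show ?thesis .
qed

definition complete_graph :: "nat \<Rightarrow> nat graph" where
  "complete_graph n = ({..<n}, {e. e \<subseteq> {..<n} \<and> card e = 2})"

lemma complete_graph_in: "complete_graph n \<in> graphs_with n (n choose 2)"
  using n_subsets[of "{..<n}" 2] by (auto simp: graphs_with_def simple_graph_def complete_graph_def)

lemma card_factors_complete_graph: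
  fixes F :: "'a graph"
  assumes F: "simple_graph F" "connected_graph F" and n: "n = card (verts F) * t"
  shows "card (factors F (complete_graph n)) * (fact t * card (Aut F) ^ t) = fact n"
proof -
  let ?T = "copies t F" and ?G = "complete_graph n"
  have ne: "verts F \<noteq> {}" using F(2) by (simp add: connected_graph_def)
  have G: "simple_graph ?G" "card (verts ?G) = card (verts F) * t"
    using complete_graph_in[of n] n by (auto simp: graphs_with_def)
  have T: "finite (verts ?T)" "card (verts ?T) = n"
    using F(1) n by (auto simp: copies_def simple_graph_def card_cartesian_product)
  have "image f ` edges ?T \<subseteq> edges ?G" if f: "f \<in> placements ?T {..<n}" for f
  proof
    fix e' assume "e' \<in> image f ` edges ?T"
    then obtain j e where e: "j < t" "e \<in> edges F" "e' = f ` Pair j ` e" by (auto simp: copies_def)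
    have sub: "Pair j ` e \<subseteq> verts ?T" using edges_copies_subset[OF F(1), of "Pair j ` e" t] e
      by (auto simp: copies_def)
    have inj: "inj_on f (verts ?T)" and img: "f ` verts ?T = {..<n}"
      using f by (auto simp: placements_def bij_betw_def)
    have "card e' = card (Pair j ` e)"
      unfolding e(3) by (rule card_image[OF inj_on_subset[OF inj sub]])
    also have "\<dots> = 2" using F(1) e(2) by (subst card_image) (auto simp: simple_graph_def inj_on_def)
    finally show "e' \<in> edges ?G" using sub img by (auto simp: complete_graph_def e(3))
  qed
  then have "{f \<in> placements ?T (verts ?G). image f ` edges ?T \<subseteq> edges ?G} = placements ?T {..<n}"
    by (auto simp: complete_graph_def)
  then have "card (factors F ?G) * card (Aut ?T) = card (placements ?T {..<n})"
    using card_placements_into[OF F(1) ne G] by simp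
  also have "\<dots> = fact n" using card_placements[of "{..<n}" ?T] T by simp
  finally show ?thesis by (simp add: card_Aut_copies[OF F])
qed

text \<open>The bound of the theorem without real exponents: for \<open>n = k * t\<close> the exponent \<open>(1 - 1 / k) * n\<close> is
  \<open>(k - 1) * t\<close>, and the root in the base disappears.\<close>

lemma powr_bound_eq:
  fixes r c x :: real and k t :: nat
  assumes "r > 0" "c > 0" "x > 0" "k \<ge> 2"
  shows "(c * r powr (1 / (real k - 1)) * x) powr ((1 - 1 / real k) * real (k * t)) = r ^ t * (c * x) ^ ((k - 1) * t)"
proof -
  have "(1 - 1 / real k) * real (k * t) = real ((k - 1) * t)"
    using assms(4) by (simp add: field_simps of_nat_diff)
  then have "(c * r powr (1 / (real k - 1)) * x) powr ((1 - 1 / real k) * real (k * t)) =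
      (c * r powr (1 / (real k - 1)) * x) powr real ((k - 1) * t)" by (rule arg_cong)
  also have "\<dots> = (c * r powr (1 / (real k - 1)) * x) ^ ((k - 1) * t)"
    using assms by (intro powr_realpow) simp
  also have "\<dots> = ((r powr (1 / (real k - 1))) ^ (k - 1)) ^ t * (c * x) ^ ((k - 1) * t)"
    by (simp add: power_mult_distrib power_mult[symmetric] mult_ac)
  also have "(r powr (1 / (real k - 1))) ^ (k - 1) = r powr (1 / (real k - 1) * real (k - 1))"
    using assms by (simp add: powr_realpow[symmetric] powr_powr)
  also have "1 / (real k - 1) * real (k - 1) = 1" using assms(4) by (simp add: of_nat_diff)
  finally show ?thesis using assms by simp
qed

lemma ln_fact_eq_sum: "ln (fact n :: real) = (\<Sum>i<n. ln (real i + 1))"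
  by (induction n) (simp_all add: ln_mult_pos add_ac)

lemma ln_fact_le: "ln (fact t :: real) \<le> (t + 1) * ln (t + 1) - t"
  using sum_ln_shift_le[of 1 t] by (simp add: ln_fact_eq_sum)

lemma ln_fact_ge: "n * ln n - n \<le> ln (fact n :: real)"
proof (induction n)
  case (Suc n)
  have "n * ln (real (Suc n)) - n * ln (real n) \<le> 1"
  proof (cases "n = 0")
    case False
    have "ln (real (Suc n) / real n) \<le> real (Suc n) / real n - 1"
      using False by (intro ln_le_minus_one) simp
    also have "\<dots> = 1 / n" using False by (simp add: field_simps)
    finally have "ln (real (Suc n)) - ln (real n) \<le> 1 / n" using False by (simp add: ln_div)
    then have "n * (ln (real (Suc n)) - ln (real n)) \<le> n * (1 / n)" by (rule mult_left_mono) simp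
    then show ?thesis using False by (simp add: right_diff_distrib)
  qed simp
  moreover have "ln (fact (Suc n) :: real) = ln (real (Suc n)) + ln (fact n)"
    by (simp add: ln_mult_pos del: of_nat_Suc)
  ultimately show ?case using Suc.IH by (simp add: algebra_simps)
qed simp

lemma card_Aut_pos:
  assumes "simple_graph F"
  shows "card (Aut F) > 0"
proof -
  have "finite (Aut F)"
    using finite_permutations[of "verts F"] assms by (auto simp: Aut_def simple_graph_def)
  moreover have "id \<in> Aut F" by (simp add: Aut_def permutes_id)
  ultimately show ?thesis by (auto simp: card_gt_0_iff)
qed

lemma two_times_choose_two:
  assumes "n > 0"
  shows "2 * real (n choose 2) = real n * (real n - 1)"
  using assms by (simp add: choose_two of_nat_diff real_of_nat_div)

text \<open>The hypothesis on \<open>m\<close> is used twice. A graph with \<open>n\<close> vertices has at most \<open>n\<^sup>2 / 2\<close> edges, so \<open>m \<ge> C n\<close>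
  makes \<open>n\<close>, and hence \<open>t\<close>, large; it also makes the average degree large in comparison with \<open>k\<close>.\<close>

lemma max_factors_upper_bound:
  fixes F :: "'a graph" and \<epsilon> :: real
  assumes F: "simple_graph F" "connected_graph F" and w: "bij_betw w {..<k} (verts F)" "k \<ge> 2"
      "\<And>i. Suc i < k \<Longrightarrow> {w i, w (Suc i)} \<in> edges F"
    and \<rho>: "0 < \<rho>" "\<rho> \<le> 1" and \<epsilon>: "\<epsilon> > 0" and excess: "(1 + \<epsilon> / 2) * exp (excess \<rho>) \<le> 1 + \<epsilon>"
    and n: "n = k * t" "n > 0" and m: "m > 0" "m \<ge> (real k / \<rho> + 2 * real k / (\<rho> * \<epsilon>)) * n"
  shows "max_factors F n m \<le> (k / card (Aut F)) ^ t * ((1 + \<epsilon>) * (2 * real m / (exp 1 * n))) ^ ((k - 1) * t)"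
proof (cases "graphs_with n m = {}")
  case True
  then show ?thesis using \<epsilon> by (simp add: max_factors_def)
next
  case False
  then have "max_factors F n m \<in> (\<lambda>G. card (factors F G)) ` graphs_with n m"
    unfolding max_factors_def using Max_in[OF finite_card_factors] by simp
  then obtain G where G: "G \<in> graphs_with n m" and N: "max_factors F n m = card (factors F G)" by blast
  have simple: "simple_graph G" and card_V: "card (verts G) = k * t" and card_E: "card (edges G) = m"
    using G n by (auto simp: graphs_with_def)
  interpret path_tilings "verts G" "edges G" k t
    using path_tilings_graph[OF simple w(2)] .
  define a where "a = real (card (Aut F))"
  have a: "a > 0" using card_Aut_pos[OF F(1)] by (simp add: a_def)
  have n0: "real n > 0" and k0: "real k > 0" using n w(2) by auto
  have "2 * m \<le> n * n"
  proof -
    have "2 * m = (\<Sum>v\<in>verts G. deg v)" using sum_deg card_E by simp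
    also have "\<dots> \<le> (\<Sum>v\<in>verts G. card (verts G))"
      by (intro sum_mono card_mono finite_V nbrs_subset)
    also have "\<dots> = n * n" using card_V n by simp
    finally show ?thesis .
  qed
  then have "2 * real m \<le> real n * real n" by (metis of_nat_le_iff of_nat_mult of_nat_numeral)
  moreover have "real k / \<rho> * n \<le> (real k / \<rho> + 2 * real k / (\<rho> * \<epsilon>)) * n"
    using \<rho> \<epsilon> by (intro mult_right_mono) auto
  ultimately have "2 * (real k / \<rho>) * n \<le> n * real n" using m(2) by linarith
  then have "2 * (real k / \<rho>) \<le> n" using n0 by (simp only: mult_le_cancel_right_pos)
  then have \<rho>t: "2 \<le> \<rho> * t" using \<rho> k0 n by (simp add: field_simps)
  also have "\<rho> * t \<le> t" using \<rho> by (intro mult_left_le_one_le) auto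
  finally have t: "t \<ge> 2" by simp
  \<comment> \<open>The degrees are enlarged by \<open>\<epsilon> / 2\<close> times the average degree \<open>2 * m / n\<close>, and \<open>B\<close> is the new average.\<close>
  define D0 where "D0 = \<epsilon> / 2 * (2 * real m / n)"
  define B where "B = (1 + \<epsilon> / 2) * (2 * real m / n)"
  have D0_pos: "D0 > 0" using \<epsilon> m n by (simp add: D0_def)
  have "2 * real k / (\<rho> * \<epsilon>) * n \<le> (real k / \<rho> + 2 * real k / (\<rho> * \<epsilon>)) * n"
    using \<rho> \<epsilon> by (intro mult_right_mono) auto
  also note m(2)
  finally have D0: "2 * k \<le> \<rho> * D0" using \<rho> \<epsilon> n0 by (simp add: D0_def field_simps)
  have B: "(\<Sum>v\<in>verts G. deg v + D0) \<le> card (verts G) * B"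
  proof -
    have "(\<Sum>v\<in>verts G. real (deg v)) = 2 * m"
      using sum_deg card_E by (metis of_nat_mult of_nat_numeral of_nat_sum)
    then have "(\<Sum>v\<in>verts G. deg v + D0) = 2 * m + n * D0"
      using card_V n by (simp add: sum.distrib)
    also have "\<dots> = card (verts G) * B"
      using n0 unfolding card_V n(1)[symmetric] by (simp add: D0_def B_def field_simps)
    finally show ?thesis by simp
  qed
  have "real (card (factors F G) * (fact t * card (Aut F) ^ t)) \<le> card tilings"
    by (intro of_nat_mono card_factors_le_card_tilings[OF F w simple card_V])
  also have "\<dots> \<le> fact t * k ^ t * (B * exp (excess \<rho> - 1)) ^ ((k - 1) * t)"
    by (rule card_tilings_le[OF card_V t \<rho>(1) \<rho>t D0_pos D0 B])
  finally have "real (card (factors F G)) * a ^ t \<le> k ^ t * (B * exp (excess \<rho> - 1)) ^ ((k - 1) * t)"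
    by (simp add: a_def mult_ac)
  also have "\<dots> \<le> k ^ t * ((1 + \<epsilon>) * (2 * real m / (exp 1 * n))) ^ ((k - 1) * t)"
  proof (intro mult_left_mono power_mono)
    have "B * exp (excess \<rho> - 1) = ((1 + \<epsilon> / 2) * exp (excess \<rho>)) * (2 * real m / (exp 1 * n))"
      by (simp add: B_def exp_diff mult_ac)
    also have "\<dots> \<le> (1 + \<epsilon>) * (2 * real m / (exp 1 * n))"
      by (intro mult_right_mono excess) simp
    finally show "B * exp (excess \<rho> - 1) \<le> (1 + \<epsilon>) * (2 * real m / (exp 1 * n))" .
  qed (use \<epsilon> in \<open>auto simp: B_def\<close>)
  finally have "real k ^ t * ((1 + \<epsilon>) * (2 * real m / (exp 1 * n))) ^ ((k - 1) * t) / a ^ t \<ge>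
      max_factors F n m"
    using a unfolding N by (simp only: pos_le_divide_eq zero_less_power of_nat_power)
  then show ?thesis by (simp only: a_def[symmetric] power_divide times_divide_eq_left)
qed

lemma max_factors_ge_complete_graph:
  fixes F :: "'a graph"
  assumes F: "simple_graph F" "connected_graph F" and n: "n = card (verts F) * t"
  shows "fact n \<le> max_factors F n (n choose 2) * (fact t * card (Aut F) ^ t)"
proof -
  have "card (factors F (complete_graph n)) \<le> max_factors F n (n choose 2)"
    using complete_graph_in[of n] Max_ge[OF finite_card_factors imageI[OF complete_graph_in[of n]]]
    by (metis empty_iff max_factors_def)
  then show ?thesis
    using card_factors_complete_graph[OF assms] by (metis mult_le_mono1)
qed

lemma eventually_ln_le_linear:
  fixes \<delta> :: real
  assumes "\<delta> > 0"
  shows "eventually (\<lambda>t::nat. 1 + ln (real t + 1) \<le> \<delta> * real t) sequentially"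
proof -
  have "eventually (\<lambda>x. ln x / x < \<delta> / 4) at_top"
    using order_tendstoD(2)[OF ln_x_over_x_tendsto_0, of "\<delta> / 4"] assms by simp
  moreover have "filterlim (\<lambda>t::nat. real t + 1) at_top sequentially"
    using filterlim_compose[OF filterlim_real_sequentially filterlim_Suc] by (simp add: add.commute)
  ultimately have "eventually (\<lambda>t::nat. ln (real t + 1) / (real t + 1) < \<delta> / 4) sequentially"
    by (rule eventually_compose_filterlim)
  moreover have "eventually (\<lambda>t::nat. 2 / \<delta> \<le> real t) sequentially"
    using filterlim_real_sequentially by (simp add: filterlim_at_top)
  ultimately show ?thesis using eventually_ge_at_top[of 1]
  proof eventually_elim
    case (elim t)
    then have "ln (real t + 1) \<le> \<delta> / 4 * (real t + 1)" by (simp add: field_simps)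
    also have "\<dots> \<le> \<delta> / 4 * (2 * real t)" using assms elim by (intro mult_left_mono) auto
    finally have "ln (real t + 1) \<le> \<delta> / 2 * t" by simp
    moreover have "1 \<le> \<delta> / 2 * t" using elim assms by (simp add: field_simps)
    ultimately show ?case by linarith
  qed
qed

text \<open>Complete graphs are asymptotically extremal. With \<open>n! / (t! * a ^ t)\<close> factors, Stirling's formula loses only a factor of
  order \<open>t\<close>, which is beaten by \<open>(1 - \<delta>) ^ ((k - 1) * t)\<close> as soon as \<open>t\<close> is large.\<close>

lemma max_factors_lower_bound:
  fixes F :: "'a graph" and \<delta> :: real
  assumes F: "simple_graph F" "connected_graph F" and k: "k = card (verts F)" "k \<ge> 2"
    and \<delta>: "0 < \<delta>" "\<delta> < 1" and n: "n = k * t" and t: "t > 0" "1 + ln (real t + 1) \<le> \<delta> * real t"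
  shows "max_factors F n (n choose 2) \<ge>
    (k / card (Aut F)) ^ t * ((1 - \<delta>) * (2 * real (n choose 2) / (exp 1 * n))) ^ ((k - 1) * t)"
proof -
  define a where "a = real (card (Aut F))"
  have a: "a > 0" using card_Aut_pos[OF F(1)] by (simp add: a_def)
  have n0: "n > 0" using n t k by simp
  have choose: "2 * real (n choose 2) = n * (real n - 1)"
    using n0 by (rule two_times_choose_two)
  let ?p = "(k - 1) * t"
  have p: "real ?p = (real k - 1) * t" using k(2) by (simp add: of_nat_diff)
  have "(2 * real (n choose 2) / (exp 1 * n)) \<le> n / exp 1"
    unfolding choose using n0 by (simp add: divide_simps)
  then have "((1 - \<delta>) * (2 * real (n choose 2) / (exp 1 * n))) ^ ?p \<le> ((1 - \<delta>) * (n / exp 1)) ^ ?p"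
    using \<delta> by (intro power_mono mult_left_mono) auto
  then have "real k ^ t * ((1 - \<delta>) * (2 * real (n choose 2) / (exp 1 * n))) ^ ?p * fact t
      \<le> real k ^ t * ((1 - \<delta>) * (n / exp 1)) ^ ?p * fact t"
    by (intro mult_right_mono mult_left_mono) auto
  also have "\<dots> \<le> fact n"
  proof (subst ln_le_cancel_iff[symmetric])
    show "0 < real k ^ t * ((1 - \<delta>) * (n / exp 1)) ^ ?p * fact t" using \<delta> n0 k by simp
    have "ln (real k ^ t * ((1 - \<delta>) * (n / exp 1)) ^ ?p * fact t) =
        t * ln k + (real k - 1) * t * (ln (1 - \<delta>) + (ln n - 1)) + ln (fact t)"
      using \<delta> n0 k by (simp add: ln_mult_pos ln_realpow ln_div p[simplified])
    also have "\<dots> \<le> t * ln k + ((real k - 1) * t * (ln n - 1) - \<delta> * t) + ((t + 1) * ln (t + 1) - t)"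
    proof -
      have "(real k - 1) * t * ln (1 - \<delta>) \<le> (real k - 1) * t * (- \<delta>)"
        using ln_le_minus_one[of "1 - \<delta>"] \<delta> k(2) by (intro mult_left_mono) auto
      also have "\<dots> = - ((real k - 1) * (\<delta> * t))" by simp
      also have "\<dots> \<le> - (1 * (\<delta> * t))"
        using k(2) \<delta> by (intro le_imp_neg_le mult_right_mono) auto
      finally show ?thesis using ln_fact_le[of t] by (simp add: algebra_simps)
    qed
    also have "(t + 1) * ln (t + 1) \<le> t * ln t + \<delta> * t"
    proof -
      have "ln ((real t + 1) / t) \<le> (real t + 1) / t - 1" using t by (intro ln_le_minus_one) simp
      also have "\<dots> = 1 / t" using t by (simp add: field_simps)
      finally have "t * ln ((real t + 1) / t) \<le> t * (1 / t)" by (rule mult_left_mono) simp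
      then have "t * (ln (real t + 1) - ln t) \<le> 1" using t by (simp add: ln_div)
      then show ?thesis using t(2) by (simp add: algebra_simps)
    qed
    also have "t * ln k + ((real k - 1) * t * (ln n - 1) - \<delta> * t) + (t * ln t + \<delta> * t - t) = n * ln n - n"
    proof -
      have "ln n = ln k + ln t" using n k t by (simp add: ln_mult_pos)
      then show ?thesis by (simp add: n algebra_simps)
    qed
    also have "\<dots> \<le> ln (fact n)" by (rule ln_fact_ge)
    finally show "ln (real k ^ t * ((1 - \<delta>) * (n / exp 1)) ^ ?p * fact t) \<le> ln (fact n)" by simp
  qed simp
  also have "\<dots> \<le> real (max_factors F n (n choose 2) * (fact t * card (Aut F) ^ t))"
    using max_factors_ge_complete_graph[OF F, of n t] n k(1) by (metis of_nat_fact of_nat_mono)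
  finally have "real k ^ t * ((1 - \<delta>) * (2 * real (n choose 2) / (exp 1 * n))) ^ ?p \<le>
      max_factors F n (n choose 2) * a ^ t"
    by (simp add: a_def)
  then have "real k ^ t * ((1 - \<delta>) * (2 * real (n choose 2) / (exp 1 * n))) ^ ?p / a ^ t \<le>
      max_factors F n (n choose 2)"
    using a by (simp only: pos_divide_le_eq zero_less_power)
  then show ?thesis by (simp only: a_def[symmetric] power_divide times_divide_eq_left)
qed

theorem theorem1p7:
  fixes F :: "'a graph"
  assumes "simple_graph F"
    and "connected_graph F"
    and "spanned_by_two_equal_cycles F"
  shows "\<forall>\<epsilon>::real. \<epsilon> > 0 \<longrightarrow> (\<exists>C::real. C > 0 \<and>
    (\<forall>n m :: nat. n > 0 \<and> m > 0 \<and> card (verts F) dvd n \<and> real m \<ge> C * real n \<longrightarrow>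
       real (max_factors F n m) \<le>
         ((1 + \<epsilon>)
           * (real (card (verts F)) / real (card (Aut F))) powr (1 / (real (card (verts F)) - 1))
           * (2 * real m / (exp 1 * real n)))
         powr ((1 - 1 / real (card (verts F))) * real n)) \<and>
    (\<forall>\<delta>::real. 0 < \<delta> \<and> \<delta> < 1 \<longrightarrow>
       infinite {(n :: nat, m :: nat). n > 0 \<and> m > 0 \<and> card (verts F) dvd n \<and> real m \<ge> C * real n \<and>
         real (max_factors F n m) \<ge>
           ((1 - \<delta>)
             * (real (card (verts F)) / real (card (Aut F))) powr (1 / (real (card (verts F)) - 1))
             * (2 * real m / (exp 1 * real n)))
           powr ((1 - 1 / real (card (verts F))) * real n)}))"
proof (intro allI impI)
  fix \<epsilon> :: real assume \<epsilon>: "\<epsilon> > 0"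
  define k where "k = card (verts F)"
  obtain w where w: "bij_betw w {..<k} (verts F)" "k \<ge> 2"
      "\<And>i. Suc i < k \<Longrightarrow> {w i, w (Suc i)} \<in> edges F"
    unfolding k_def using hamiltonian_path[OF assms] by metis
  have a: "card (Aut F) > 0" using card_Aut_pos[OF assms(1)] .
  have r: "real k / real (card (Aut F)) > 0" using a w(2) by simp
  have "ln ((1 + \<epsilon>) / (1 + \<epsilon> / 2)) > 0" using \<epsilon> by simp
  then have "eventually (\<lambda>\<rho>. excess \<rho> < ln ((1 + \<epsilon>) / (1 + \<epsilon> / 2))) (at_right 0)"
    by (rule order_tendstoD(2)[OF tendsto_excess])
  moreover have "eventually (\<lambda>\<rho>::real. \<rho> \<in> {0<..<1}) (at_right 0)"
    by (rule eventually_at_right_real) simp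
  ultimately have "eventually (\<lambda>\<rho>::real. excess \<rho> < ln ((1 + \<epsilon>) / (1 + \<epsilon> / 2)) \<and> \<rho> \<in> {0<..<1}) (at_right 0)"
    by eventually_elim simp
  from eventually_happens'[OF trivial_limit_at_right_real this] obtain \<rho> :: real
    where \<rho>_ex: "excess \<rho> < ln ((1 + \<epsilon>) / (1 + \<epsilon> / 2)) \<and> \<rho> \<in> {0<..<1}" ..
  then have \<rho>: "0 < \<rho>" "\<rho> \<le> 1" and ex: "excess \<rho> < ln ((1 + \<epsilon>) / (1 + \<epsilon> / 2))" by simp_all
  have "exp (excess \<rho>) \<le> exp (ln ((1 + \<epsilon>) / (1 + \<epsilon> / 2)))" using ex by simp
  also have "\<dots> = (1 + \<epsilon>) / (1 + \<epsilon> / 2)" using \<epsilon> by (intro exp_ln) simp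
  finally have excess: "(1 + \<epsilon> / 2) * exp (excess \<rho>) \<le> 1 + \<epsilon>"
    using \<epsilon> by (simp add: pos_le_divide_eq mult.commute)
  define C where "C = real k / \<rho> + 2 * real k / (\<rho> * \<epsilon>)"
  have C: "C > 0" unfolding C_def using \<rho> \<epsilon> w(2) by (intro add_pos_pos divide_pos_pos mult_pos_pos) auto
  show "\<exists>C::real. C > 0 \<and>
    (\<forall>n m :: nat. n > 0 \<and> m > 0 \<and> card (verts F) dvd n \<and> real m \<ge> C * real n \<longrightarrow>
       real (max_factors F n m) \<le>
         ((1 + \<epsilon>)
           * (real (card (verts F)) / real (card (Aut F))) powr (1 / (real (card (verts F)) - 1))
           * (2 * real m / (exp 1 * real n)))
         powr ((1 - 1 / real (card (verts F))) * real n)) \<and>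
    (\<forall>\<delta>::real. 0 < \<delta> \<and> \<delta> < 1 \<longrightarrow>
       infinite {(n :: nat, m :: nat). n > 0 \<and> m > 0 \<and> card (verts F) dvd n \<and> real m \<ge> C * real n \<and>
         real (max_factors F n m) \<ge>
           ((1 - \<delta>)
             * (real (card (verts F)) / real (card (Aut F))) powr (1 / (real (card (verts F)) - 1))
             * (2 * real m / (exp 1 * real n)))
           powr ((1 - 1 / real (card (verts F))) * real n)})"
    unfolding k_def[symmetric]
  proof (intro exI[of _ C] conjI allI impI; (elim conjE)?)
    show "C > 0" by (rule C)
  next
    fix n m :: nat assume n: "n > 0" and m: "m > 0" and dvd: "k dvd n" and mC: "real m \<ge> C * real n"
    obtain t where t: "n = k * t" using dvd by auto
    have "real (max_factors F n m) \<le>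
        (k / card (Aut F)) ^ t * ((1 + \<epsilon>) * (2 * real m / (exp 1 * n))) ^ ((k - 1) * t)"
      by (rule max_factors_upper_bound[OF assms(1,2) w \<rho> \<epsilon> excess t n m mC[unfolded C_def]])
    also have "\<dots> = ((1 + \<epsilon>) * (real k / card (Aut F)) powr (1 / (real k - 1)) * (2 * real m / (exp 1 * n)))
        powr ((1 - 1 / real k) * real n)"
    proof -
      have "2 * real m / (exp 1 * n) > 0" "1 + \<epsilon> > 0" using n m \<epsilon> by simp_all
      from powr_bound_eq[OF r this(2,1) w(2), of t] show ?thesis by (simp only: t)
    qed
    finally show "real (max_factors F n m) \<le>
        ((1 + \<epsilon>) * (real k / card (Aut F)) powr (1 / (real k - 1)) * (2 * real m / (exp 1 * n)))
        powr ((1 - 1 / real k) * real n)" .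
  next
    fix \<delta> :: real assume \<delta>: "0 < \<delta>" "\<delta> < 1"
    let ?S = "{(n :: nat, m :: nat). n > 0 \<and> m > 0 \<and> k dvd n \<and> C * real n \<le> real m \<and>
         ((1 - \<delta>) * (real k / real (card (Aut F))) powr (1 / (real k - 1)) * (2 * real m / (exp 1 * real n)))
           powr ((1 - 1 / real k) * real n) \<le> real (max_factors F n m)}"
    have "eventually (\<lambda>t::nat. 2 * C + 1 \<le> real t) sequentially"
      using filterlim_real_sequentially by (simp add: filterlim_at_top)
    then have "eventually (\<lambda>t::nat. 1 + ln (real t + 1) \<le> \<delta> * real t \<and> 2 * C + 1 \<le> real t \<and> t > 0) sequentially"
      using eventually_ln_le_linear[OF \<delta>(1)] eventually_gt_at_top[of 0] by eventually_elim simp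
    then obtain T where T: "\<And>t. t \<ge> T \<Longrightarrow> 1 + ln (real t + 1) \<le> \<delta> * real t \<and> 2 * C + 1 \<le> real t \<and> t > 0"
      unfolding eventually_at_top_linorder by blast
    \<comment> \<open>The complete graph on \<open>k * t\<close> vertices, for all large \<open>t\<close>.\<close>
    define pair where "pair t = (k * t, k * t choose 2)" for t
    have "pair t \<in> ?S" if "t \<ge> T" for t
    proof -
      let ?n = "k * t"
      have t: "1 + ln (real t + 1) \<le> \<delta> * real t" "2 * C + 1 \<le> real t" "t > 0" using T[OF that] by auto
      have n0: "?n > 0" using w(2) t by simp
      have "t \<le> ?n" using w(2) by simp
      then have "real t \<le> real ?n" by (rule of_nat_mono)
      then have n: "2 * C + 1 \<le> real ?n" using t(2) by linarith
      have choose: "2 * real (?n choose 2) = real ?n * (real ?n - 1)"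
        using n0 by (intro two_times_choose_two)
      have "2 * C * real ?n \<le> (real ?n - 1) * real ?n" using n by (intro mult_right_mono) auto
      then have mC: "C * real ?n \<le> real (?n choose 2)" using choose by (simp add: mult.commute)
      moreover have "0 < C * real ?n" using C n0 by (intro mult_pos_pos) auto
      ultimately have m0: "real (?n choose 2) > 0" by linarith
      have "((1 - \<delta>) * (real k / real (card (Aut F))) powr (1 / (real k - 1)) *
          (2 * real (?n choose 2) / (exp 1 * real ?n))) powr ((1 - 1 / real k) * real ?n) =
          (k / card (Aut F)) ^ t * ((1 - \<delta>) * (2 * real (?n choose 2) / (exp 1 * ?n))) ^ ((k - 1) * t)"
        using \<delta> m0 n0 by (intro powr_bound_eq[OF r _ _ w(2)]) simp_all
      also have "\<dots> \<le> max_factors F ?n (?n choose 2)"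
        by (rule max_factors_lower_bound[OF assms(1,2) k_def w(2) \<delta> refl t(3,1)])
      finally show ?thesis using n0 m0 mC by (simp add: pair_def)
    qed
    then have "pair ` {T..} \<subseteq> ?S" by (intro image_subsetI) (simp only: atLeast_iff)
    moreover have "inj_on pair {T..}"
    proof (rule inj_onI)
      fix t t' assume "pair t = pair t'"
      then have "k * t = k * t'" by (simp only: pair_def prod.inject)
      then show "t = t'" using w(2) by simp
    qed
    then have "infinite (pair ` {T..})" using infinite_Ici[of T] by (simp only: finite_image_iff) simp
    ultimately show "infinite ?S" by (rule infinite_super)
  qed
qed

end
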